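(* Let $\varphi\in L^2(\mathbb{R}^2,\mathbb{H})$ be a quaternion window function (i.e. $\varphi$ is not the zero function). Then every function $f\in L^2(\mathbb{R}^2,\mathbb{H})$ can be reconstructed from its Gabor quaternionic Fourier transform $\mathcal{G}_\varphi f$ by $$f(x)=\frac{1}{\|\varphi\|_2^2}\int_{\mathbb{R}^2}\int_{\mathbb{R}^2}e^{2\pi i x_1\omega_1}\,\mathcal{G}_\varphi f(\omega,b)\,e^{2\pi j x_2\omega_2}\,\varphi(x-b)\,d\omega\,db .$$
   Context: $\mathbb{H}$ is the real quaternion algebra with units $i,j,k$ ($i^2=j^2=k^2=ijk=-1$), conjugation $\overline{q}$ and modulus $|q|=\sqrt{q\overline{q}}$. $L^2(\mathbb{R}^2,\mathbb{H})$ is the space of functions $f:\mathbb{R}^2\to\mathbb{H}$ with $\|f\|_2^2=\int_{\mathbb{R}^2}|f(x)|^2dx<\infty$. Points are written $x=(x_1,x_2)$, $\omega=(\omega_1,\omega_2)$, $b=(b_1,b_2)\in\mathbb{R}^2$. The (two-sided) Gabor quaternionic Fourier transform (GQFT) of $f\in L^2(\mathbb{R}^2,\mathbb{H})$ with respect to a non-zero quaternion window function $\varphi\in L^2(\mathbb{R}^2,\mathbb{H})$ is $$\mathcal{G}_\varphi f(\omega,b)=\int_{\mathbb{R}^2}e^{-2\pi i x_1\omega_1}f(x)\overline{\varphi(x-b)}e^{-2\pi j x_2\omega_2}dx,\qquad \omega,b\in\mathbb{R}^2 .$$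
   Formalization: For general f the ω-integral need not converge (e.g. f = φ = indicator of a square), so the formula is proved as an L² limit over any increasing finite-measure exhaustion of the ω-plane, and literally at almost every x for which the inner integral converges absolutely for a.e. b. *)

theory Defs
  imports "HOL-Analysis.Analysis"
begin

datatype quat = Quat (qRe: real) (qI: real) (qJ: real) (qK: real)

lemma quat_eq_iff: "x = y \<longleftrightarrow> qRe x = qRe y \<and> qI x = qI y \<and> qJ x = qJ y \<and> qK x = qK y"
  by (cases x; cases y) auto

instantiation quat :: real_vector
begin

definition zero_quat_def: "0 = Quat 0 0 0 0"
definition plus_quat_def: "x + y = Quat (qRe x + qRe y) (qI x + qI y) (qJ x + qJ y) (qK x + qK y)"
definition uminus_quat_def: "- x = Quat (- qRe x) (- qI x) (- qJ x) (- qK x)"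
definition minus_quat_def: "x - y = Quat (qRe x - qRe y) (qI x - qI y) (qJ x - qJ y) (qK x - qK y)"
definition scaleR_quat_def: "r *\<^sub>R x = Quat (r * qRe x) (r * qI x) (r * qJ x) (r * qK x)"

lemma quat_vector_sel [simp]:
  "qRe 0 = 0" "qI 0 = 0" "qJ 0 = 0" "qK 0 = 0"
  "qRe (x + y) = qRe x + qRe y" "qI (x + y) = qI x + qI y"
  "qJ (x + y) = qJ x + qJ y" "qK (x + y) = qK x + qK y"
  "qRe (- x) = - qRe x" "qI (- x) = - qI x" "qJ (- x) = - qJ x" "qK (- x) = - qK x"
  "qRe (x - y) = qRe x - qRe y" "qI (x - y) = qI x - qI y"
  "qJ (x - y) = qJ x - qJ y" "qK (x - y) = qK x - qK y"
  "qRe (r *\<^sub>R x) = r * qRe x" "qI (r *\<^sub>R x) = r * qI x"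
  "qJ (r *\<^sub>R x) = r * qJ x" "qK (r *\<^sub>R x) = r * qK x"
  by (simp_all add: zero_quat_def plus_quat_def uminus_quat_def minus_quat_def scaleR_quat_def)

instance
  by standard (auto simp: quat_eq_iff algebra_simps)

end

instantiation quat :: real_algebra_1
begin

definition one_quat_def: "1 = Quat 1 0 0 0"

definition times_quat_def: "x * y = Quat
   (qRe x * qRe y - qI x * qI y - qJ x * qJ y - qK x * qK y)
   (qRe x * qI y + qI x * qRe y + qJ x * qK y - qK x * qJ y)
   (qRe x * qJ y - qI x * qK y + qJ x * qRe y + qK x * qI y)
   (qRe x * qK y + qI x * qJ y - qJ x * qI y + qK x * qRe y)"

lemma quat_ring_sel [simp]:
  "qRe 1 = 1" "qI 1 = 0" "qJ 1 = 0" "qK 1 = 0"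
  "qRe (x * y) = qRe x * qRe y - qI x * qI y - qJ x * qJ y - qK x * qK y"
  "qI (x * y) = qRe x * qI y + qI x * qRe y + qJ x * qK y - qK x * qJ y"
  "qJ (x * y) = qRe x * qJ y - qI x * qK y + qJ x * qRe y + qK x * qI y"
  "qK (x * y) = qRe x * qK y + qI x * qJ y - qJ x * qI y + qK x * qRe y"
  by (simp_all add: one_quat_def times_quat_def)

instance
  by standard (auto simp: quat_eq_iff algebra_simps)

end

definition quat_i :: quat where "quat_i = Quat 0 1 0 0"
definition quat_j :: quat where "quat_j = Quat 0 0 1 0"
definition quat_k :: quat where "quat_k = Quat 0 0 0 1"

lemma quat_units:
  "quat_i * quat_i = - 1" "quat_j * quat_j = - 1" "quat_k * quat_k = - 1"
  "quat_i * quat_j * quat_k = - 1"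
  by (simp_all add: quat_eq_iff quat_i_def quat_j_def quat_k_def)

definition qcnj :: "quat \<Rightarrow> quat"
  where "qcnj q = Quat (qRe q) (- qI q) (- qJ q) (- qK q)"

lemma qcnj_sel [simp]:
  "qRe (qcnj q) = qRe q" "qI (qcnj q) = - qI q" "qJ (qcnj q) = - qJ q" "qK (qcnj q) = - qK q"
  by (simp_all add: qcnj_def)

instantiation quat :: real_inner
begin

definition inner_quat_def:
  "inner x y = qRe x * qRe y + qI x * qI y + qJ x * qJ y + qK x * qK y"

definition norm_quat_def:
  "norm q = sqrt ((qRe q)\<^sup>2 + (qI q)\<^sup>2 + (qJ q)\<^sup>2 + (qK q)\<^sup>2)"

definition sgn_quat_def: "sgn (x :: quat) = x /\<^sub>R norm x"

definition dist_quat_def: "dist x (y :: quat) = norm (x - y)"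

definition uniformity_quat_def [code del]:
  "(uniformity :: (quat \<times> quat) filter) = (INF e\<in>{0 <..}. principal {(x, y). dist x y < e})"

definition open_quat_def [code del]:
  "open (U :: quat set) \<longleftrightarrow> (\<forall>x\<in>U. eventually (\<lambda>(x', y). x' = x \<longrightarrow> y \<in> U) uniformity)"

instance
proof
  fix x y z :: quat and r :: real and U :: "quat set"
  show "inner x y = inner y x" "inner (x + y) z = inner x z + inner y z"
    "inner (r *\<^sub>R x) y = r * inner x y" "0 \<le> inner x x"
    by (simp_all add: inner_quat_def algebra_simps)
  show "(inner x x = 0) = (x = 0)"
    by (auto simp: inner_quat_def quat_eq_iff add_nonneg_eq_0_iff)
  show "norm x = sqrt (inner x x)"
    by (simp add: norm_quat_def inner_quat_def power2_eq_square)
qed (rule sgn_quat_def dist_quat_def open_quat_def uniformity_quat_def)+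

end

lemma mult_qcnj: "q * qcnj q = of_real ((norm q)\<^sup>2)"
  by (simp add: quat_eq_iff norm_quat_def of_real_def power2_eq_square)

lemma four_squares:
  fixes a b c d e f g h :: real
  shows "(a * e - b * f - c * g - d * h)\<^sup>2 + (a * f + b * e + c * h - d * g)\<^sup>2
    + (a * g - b * h + c * e + d * f)\<^sup>2 + (a * h + b * g - c * f + d * e)\<^sup>2
    = (a\<^sup>2 + b\<^sup>2 + c\<^sup>2 + d\<^sup>2) * (e\<^sup>2 + f\<^sup>2 + g\<^sup>2 + h\<^sup>2)"
  by (simp only: power2_eq_square distrib_left distrib_right left_diff_distrib right_diff_distrib)
    (simp add: algebra_simps)

instantiation quat :: real_normed_div_algebra
begin

definition inverse_quat_def: "inverse q = qcnj q /\<^sub>R (norm q)\<^sup>2"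

definition divide_quat_def: "x div (y :: quat) = x * inverse y"

instance
proof
  fix x y :: quat
  have nz: "(norm x)\<^sup>2 \<noteq> 0" if "x \<noteq> 0"
    using that by simp
  have comm: "qcnj x * x = x * qcnj x"
    by (simp add: quat_eq_iff)
  have one: "(of_real ((norm x)\<^sup>2) :: quat) /\<^sub>R (norm x)\<^sup>2 = 1" if "x \<noteq> 0"
    using nz[OF that] by (simp add: of_real_def)
  show "x \<noteq> 0 \<Longrightarrow> x * inverse x = 1"
    unfolding inverse_quat_def mult_scaleR_right mult_qcnj by (rule one)
  show "x \<noteq> 0 \<Longrightarrow> inverse x * x = 1"
    unfolding inverse_quat_def mult_scaleR_left comm mult_qcnj by (rule one)
  show "x div y = x * inverse y"
    by (rule divide_quat_def)
  show "inverse (0 :: quat) = 0"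
    by (simp add: inverse_quat_def quat_eq_iff)
  show "norm (x * y) = norm x * norm y"
    unfolding norm_quat_def real_sqrt_mult [symmetric] quat_ring_sel
    by (rule arg_cong[where f = sqrt], rule four_squares)
qed

end

instantiation quat :: euclidean_space
begin

definition Basis_quat_def: "Basis = {1, quat_i, quat_j, quat_k}"

instance
proof
  note sel = quat_i_def quat_j_def quat_k_def one_quat_def
  show "(Basis :: quat set) \<noteq> {}" "finite (Basis :: quat set)"
    by (simp_all add: Basis_quat_def)
  show "inner u v = (if u = v then 1 else 0)" if "u \<in> Basis" "v \<in> Basis" for u v :: quat
    using that unfolding Basis_quat_def sel
    by (elim insertE emptyE; simp only: inner_quat_def quat.sel quat.inject; simp)
  show "(\<forall>u\<in>Basis. inner x u = 0) \<longleftrightarrow> x = 0" for x :: quat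
    unfolding Basis_quat_def sel ball_simps inner_quat_def quat.sel quat_eq_iff[of x] by simp
qed

end

definition L2 :: "(real ^ 2 \<Rightarrow> quat) set"
  where "L2 = {f \<in> borel_measurable lebesgue. integrable lebesgue (\<lambda>x. (norm (f x))\<^sup>2)}"

definition L2norm :: "(real ^ 2 \<Rightarrow> quat) \<Rightarrow> real"
  where "L2norm f = sqrt (LINT x|lebesgue. (norm (f x))\<^sup>2)"

definition L2_tendsto :: "(nat \<Rightarrow> real ^ 2 \<Rightarrow> quat) \<Rightarrow> (real ^ 2 \<Rightarrow> quat) \<Rightarrow> bool"
  where "L2_tendsto F f \<longleftrightarrow>
    f \<in> L2 \<and> (\<forall>n. F n \<in> L2) \<and> (\<lambda>n. L2norm (\<lambda>x. F n x - f x)) \<longlonglongrightarrow> 0"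

definition gqft :: "(real ^ 2 \<Rightarrow> quat) \<Rightarrow> (real ^ 2 \<Rightarrow> quat) \<Rightarrow> real ^ 2 \<Rightarrow> real ^ 2 \<Rightarrow> quat"
  where "gqft \<phi> f \<omega> b =
    (LINT x|lebesgue. exp (- (2 * pi * x $ 1 * \<omega> $ 1) *\<^sub>R quat_i) * f x * qcnj (\<phi> (x - b))
                       * exp (- (2 * pi * x $ 2 * \<omega> $ 2) *\<^sub>R quat_j))"

definition gqft_synthesis ::
    "(real ^ 2 \<Rightarrow> quat) \<Rightarrow> (real ^ 2 \<Rightarrow> quat) \<Rightarrow> real ^ 2 \<Rightarrow> real ^ 2 \<Rightarrow> real ^ 2 \<Rightarrow> quat"
  where "gqft_synthesis \<phi> f x \<omega> b =
    exp ((2 * pi * x $ 1 * \<omega> $ 1) *\<^sub>R quat_i) * gqft \<phi> f \<omega> b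
      * exp ((2 * pi * x $ 2 * \<omega> $ 2) *\<^sub>R quat_j) * \<phi> (x - b)"

text \<open>
  For general square-integrable \<open>f\<close> the frequency integral in the reconstruction formula does not
  converge absolutely: if \<open>f\<close> and \<open>\<phi>\<close> are indicators of a square, then \<open>gqft \<phi> f \<omega> b\<close> is not
  integrable in \<open>\<omega>\<close>, although it is square-integrable for almost every \<open>b\<close>.  As in Plancherel
  theory, the equation \<open>f(x) = (1 / \<parallel>\<phi>\<parallel>\<^sup>2) \<integral>\<integral> gqft_synthesis \<phi> f x \<omega> b d\<omega> db\<close> is therefore an
  identity in \<open>L2\<close>: the frequency integral is truncated to an arbitrary increasing sequence of
  sets of finite measure exhausting the plane, for which the double integral converges absolutely
  at every \<open>x\<close>, and the limit is taken in the \<open>L2\<close> norm.  The equation with untruncated Lebesgue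
  integrals is meaningful, and claimed, at almost every \<open>x\<close> for which the inner integral exists.
\<close>

end

theory Submission
  imports Defs "HOL-Probability.Characteristic_Functions"
begin

text \<open>
  For each shift \<open>b\<close> the transform \<open>gqft \<phi> f \<omega> b\<close> is the two-sided Fourier transform of
  \<open>h\<^sub>b(x) = f(x) qcnj (\<phi>(x - b))\<close>, and \<open>\<integral> h\<^sub>b(x) \<phi>(x - b) db = \<parallel>\<phi>\<parallel>\<^sup>2 f(x)\<close>.  By the Plancherel theorem the
  error of inverting the transform of \<open>h\<^sub>b\<close> from the frequencies in \<open>K\<close> is the energy of that transform
  outside \<open>K\<close>; Cauchy-Schwarz in \<open>b\<close> then bounds the reconstruction error by the integral of these
  energies, which tends to 0 by dominated convergence.

  The Plancherel theorem itself needs no reduction to the complex case: multiplication by unit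
  quaternions from both sides is an isometry, so \<open>\<bar>F h(\<omega>)\<bar>\<^sup>2\<close> is the transform of an autocorrelation of
  \<open>h\<close>, and integrating it against a Gaussian weight in \<open>\<omega>\<close> produces a real approximate identity.
\<close>

section \<open>The two-sided Fourier kernel\<close>

text \<open>The window stands to the right of the exponential in j, so after inversion
  \<open>qcnj (\<phi> (x - b))\<close> meets \<open>\<phi> (x - b)\<close> directly and their
  product is a real number; this is why non-commutativity does no harm in the last step. The real
  obstacle is integrability. The windowed signal h_b is a product of two square-integrable
  functions, hence integrable for every shift b, so its transform is defined and bounded everywhere;
  but it is square-integrable only for almost every b. Plancherel is therefore proved for functions
  that are both integrable and square-integrable, and frequency sets of finite measure turn the
  truncated inverse into a convergent integral for all b and x. Its error comes from expanding a
  square, with Plancherel applied both to h and to its cut-off transform. The Gaussian weight is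
  there because, before Plancherel is proved, |F h|^2 is only known to be bounded. The untruncated
  identity follows from the same error formula through a subsequence converging almost
  everywhere.\<close>

lemma exp_scaleR_imaginary_unit:
  fixes A :: "'a::{real_normed_algebra_1,banach}"
  assumes A: "A * A = - 1"
  shows "exp (t *\<^sub>R A) = cos t *\<^sub>R 1 + sin t *\<^sub>R A"
proof -
  \<comment> \<open>The quotient of the two sides:
    \<open>cos t *\<^sub>R 1 - sin t *\<^sub>R A\<close> is the inverse of the right-hand side. Its
    derivative vanishes, so it keeps its value 1 at \<open>t = 0\<close>.\<close>
  let ?g = "\<lambda>t. exp (t *\<^sub>R A) * (cos t *\<^sub>R 1 - sin t *\<^sub>R A)"
  have der: "(?g has_vector_derivative 0) (at t)" for t
  proof -
    have "(?g has_vector_derivative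
        exp (t *\<^sub>R A) * ((- sin t) *\<^sub>R 1 - cos t *\<^sub>R A) +
        exp (t *\<^sub>R A) * A * (cos t *\<^sub>R 1 - sin t *\<^sub>R A)) (at t)"
      by (rule has_vector_derivative_mult[OF exp_scaleR_has_vector_derivative_right])
         (auto intro!: derivative_eq_intros)
    also have "exp (t *\<^sub>R A) * ((- sin t) *\<^sub>R 1 - cos t *\<^sub>R A) +
        exp (t *\<^sub>R A) * A * (cos t *\<^sub>R 1 - sin t *\<^sub>R A) = 0"
      by (simp add: algebra_simps A)
    finally show ?thesis .
  qed
  obtain c where c: "\<And>t. t \<in> UNIV \<Longrightarrow> ?g t = c"
    using has_vector_derivative_zero_constant[OF convex_UNIV has_vector_derivative_at_within[OF der]]
    by blast
  have g: "?g t = 1" using c[of 0, OF UNIV_I] c[of t, OF UNIV_I] by simp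
  have "(cos t *\<^sub>R 1 - sin t *\<^sub>R A) * (cos t *\<^sub>R 1 + sin t *\<^sub>R A)
      = (cos t * cos t + sin t * sin t) *\<^sub>R 1"
    by (simp add: algebra_simps A del: sin_cos_squared_add3)
  also have "\<dots> = 1"
    by (simp only: sin_cos_squared_add3 scaleR_one)
  finally have "exp (t *\<^sub>R A) = ?g t * (cos t *\<^sub>R 1 + sin t *\<^sub>R A)"
    unfolding mult.assoc by simp
  then show ?thesis
    unfolding g by simp
qed

text \<open>The exponentials stand on opposite sides of \<open>q\<close> and cannot be collected
  into one scalar factor. Treated as a single linear map of \<open>q\<close>, they form an isometry,
  and the point \<open>- x\<close> gives the inverse map.\<close>

definition qker :: "real ^ 2 \<Rightarrow> real ^ 2 \<Rightarrow> quat \<Rightarrow> quat"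
  where "qker \<omega> x q = exp (- (2 * pi * x $ 1 * \<omega> $ 1) *\<^sub>R quat_i) * q
                       * exp (- (2 * pi * x $ 2 * \<omega> $ 2) *\<^sub>R quat_j)"

lemma qker_trig:
  "qker \<omega> x q =
    (cos (2 * pi * (x $ 1) * \<omega> $ 1) *\<^sub>R 1 - sin (2 * pi * (x $ 1) * \<omega> $ 1) *\<^sub>R quat_i) * q
    * (cos (2 * pi * (x $ 2) * \<omega> $ 2) *\<^sub>R 1 - sin (2 * pi * (x $ 2) * \<omega> $ 2) *\<^sub>R quat_j)"
  unfolding qker_def exp_scaleR_imaginary_unit[OF quat_units(1)]
    exp_scaleR_imaginary_unit[OF quat_units(2)] by simp

lemma norm_trig_unit:
  "norm (cos t *\<^sub>R 1 - sin t *\<^sub>R quat_i) = 1" "norm (cos t *\<^sub>R 1 - sin t *\<^sub>R quat_j) = 1"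
  by (simp_all add: norm_quat_def quat_i_def quat_j_def)

lemma norm_qker [simp]: "norm (qker \<omega> x q) = norm q"
  by (simp add: qker_trig norm_mult norm_trig_unit)

text \<open>The exponents contain only products of coordinates of \<open>x\<close> and
  \<open>\<omega>\<close>. This symmetry allows the inverse transform to be written as
  \<open>qft\<close> evaluated at \<open>- x\<close>.\<close>

lemma qker_commute: "qker \<omega> x = qker x \<omega>"
  by (simp add: qker_def fun_eq_iff mult_ac)

text \<open>On each side only multiples of a single unit are exponentiated, and these commute with
  each other; hence the kernel is an action of the group of translations although i and j do not
  commute.\<close>

lemma qker_add: "qker \<omega> (x + y) q = qker \<omega> x (qker \<omega> y q)"
proof -
  have "exp ((s + t) *\<^sub>R A) = exp (s *\<^sub>R A) * exp (t *\<^sub>R A)" for s t and A :: quat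
    by (simp add: scaleR_add_left exp_add_commuting)
  \<comment> \<open>On the right the factors nest in the opposite order, so the second instance
    takes \<open>y\<close> before \<open>x\<close>.\<close>
  from this[of "- (2 * pi * x $ 1 * \<omega> $ 1)" "- (2 * pi * y $ 1 * \<omega> $ 1)"]
    this[of "- (2 * pi * y $ 2 * \<omega> $ 2)" "- (2 * pi * x $ 2 * \<omega> $ 2)"]
  show ?thesis
    unfolding qker_def by (simp add: algebra_simps)
qed

lemma qker_zero_left [simp]: "qker 0 x q = q"
  by (simp add: qker_def)

lemma qker_zero [simp]: "qker \<omega> x 0 = 0"
  by (simp add: qker_def)

lemma bounded_linear_qker: "bounded_linear (qker \<omega> x)"
  unfolding qker_def
  by (intro bounded_linear_compose[OF bounded_linear_mult_left bounded_linear_mult_right])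

lemma continuous_qker [continuous_intros]:
  fixes S :: "'z::t2_space set"
  assumes "continuous_on S w" "continuous_on S x" "continuous_on S q"
  shows "continuous_on S (\<lambda>z. qker (w z) (x z) (q z))"
  unfolding qker_trig using assms
  by (intro continuous_intros continuous_on_component)

lemma borel_measurable_qker [measurable]:
  assumes [measurable]: "w \<in> borel_measurable M" "x \<in> borel_measurable M" "q \<in> borel_measurable M"
  shows "(\<lambda>z. qker (w z) (x z) (q z)) \<in> borel_measurable M"
proof -
  have "continuous_on UNIV (\<lambda>p. qker (fst p) (fst (snd p)) (snd (snd p)))"
    by (intro continuous_intros)
  then have [measurable]: "(\<lambda>p. qker (fst p) (fst (snd p)) (snd (snd p))) \<in> borel_measurable borel"
    by (rule borel_measurable_continuous_onI)
  have "(\<lambda>z. (w z, x z, q z)) \<in> M \<rightarrow>\<^sub>M borel"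
    by measurable
  from measurable_compose[OF this, of "\<lambda>p. qker (fst p) (fst (snd p)) (snd (snd p))"]
  show ?thesis by simp
qed

section \<open>Isometry and adjoint of the kernel\<close>

lemma inner_isometry:
  assumes "linear T" "\<And>q. norm (T q) = norm (q::'a::real_inner)"
  shows "inner (T p) (T q) = inner p q"
proof -
  have "inner (T p) (T q) = ((norm (T p + T q))\<^sup>2 - (norm (T p))\<^sup>2 - (norm (T q))\<^sup>2) / 2"
    by (simp add: power2_norm_eq_inner algebra_simps inner_commute)
  also have "T p + T q = T (p + q)" using assms(1) by (simp add: linear_add)
  also have "((norm (T (p + q)))\<^sup>2 - (norm (T p))\<^sup>2 - (norm (T q))\<^sup>2) / 2 = inner p q"
    unfolding assms(2) by (simp add: power2_norm_eq_inner algebra_simps inner_commute)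
  finally show ?thesis .
qed

lemma inner_qker: "inner (qker \<omega> x p) (qker \<omega> x q) = inner p q"
  by (rule inner_isometry) (simp_all add: bounded_linear_qker bounded_linear.linear)

lemma inner_qker_shift: "inner (qker \<omega> x p) (qker \<omega> (x + v) q) = inner p (qker \<omega> v q)"
  by (simp add: qker_add inner_qker)

text \<open>For an isometric group action the adjoint is the inverse; this is the relation behind
  Parseval's identity below.\<close>

lemma inner_qker_left: "inner (qker \<omega> x p) q = inner p (qker \<omega> (- x) q)"
  using inner_qker_shift[of \<omega> x p "- x" q] by (simp add: qker_commute[of _ 0])

section \<open>Gaussian integrals against the kernel\<close>

text \<open>This is the characteristic function of the standard normal distribution after the
  substitution of \<open>e * x\<close> for the variable. With \<open>2 * pi\<close> in the exponent
  the result is a normalised density, of standard deviation \<open>e / (2 * pi)\<close>.\<close>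

lemma has_bochner_integral_gauss_iexp:
  fixes v e :: real
  assumes e: "0 < e"
  shows "has_bochner_integral lborel (\<lambda>x. exp (- (e * x)\<^sup>2 / 2) *\<^sub>R iexp (2 * pi * v * x))
    (complex_of_real (normal_density 0 (e / (2 * pi)) v))"
proof -
  \<comment> \<open>\<open>t\<close> is the argument of the characteristic function for which
    \<open>t * (e * x)\<close> is the wanted phase; \<open>s\<close> removes the normalising factor
    of the standard normal density.\<close>
  define t where "t = 2 * pi * v / e"
  define s where "s = sqrt (2 * pi)"
  have s: "s > 0" "s * s = 2 * pi"
    by (simp_all add: s_def)
  have te: "t * (0 + e * x) = 2 * pi * v * x" for x
    using e by (simp add: t_def)
  have int: "integrable lborel (\<lambda>x. std_normal_density x *\<^sub>R iexp (t * x))"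
    by (rule Bochner_Integration.integrable_bound[of _ std_normal_density])
       auto
  have "(LINT x|lborel. std_normal_density x *\<^sub>R iexp (t * x)) = char std_normal_distribution t"
    unfolding char_def by (subst integral_density) auto
  also have "\<dots> = complex_of_real (exp (- t\<^sup>2 / 2))"
    by (simp add: char_std_normal_distribution)
  finally have "has_bochner_integral lborel (\<lambda>x. std_normal_density x *\<^sub>R iexp (t * x))
      (complex_of_real (exp (- t\<^sup>2 / 2)))"
    using int by (simp add: has_bochner_integral_iff)
  then have "has_bochner_integral lborel (\<lambda>x. std_normal_density (0 + e * x) *\<^sub>R iexp (t * (0 + e * x)))
      (complex_of_real (exp (- t\<^sup>2 / 2)) /\<^sub>R \<bar>e\<bar>)"
    by (subst (asm) lborel_has_bochner_integral_real_affine_iff[where c=e and t=0]) (use e in auto)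
  then have "has_bochner_integral lborel
      (\<lambda>x. s *\<^sub>R (std_normal_density (0 + e * x) *\<^sub>R iexp (t * (0 + e * x))))
      (s *\<^sub>R (complex_of_real (exp (- t\<^sup>2 / 2)) /\<^sub>R \<bar>e\<bar>))"
    by (rule has_bochner_integral_scaleR_right)
  moreover have "s *\<^sub>R (std_normal_density (0 + e * x) *\<^sub>R iexp (t * (0 + e * x)))
      = exp (- (e * x)\<^sup>2 / 2) *\<^sub>R iexp (2 * pi * v * x)" for x
    unfolding te std_normal_density_def s_def[symmetric] scaleR_scaleR using s by simp
  moreover have "s * (exp (- t\<^sup>2 / 2) / e) = normal_density 0 (e / (2 * pi)) v"
  proof -
    have "sqrt (2 * pi * (e / (2 * pi))\<^sup>2) = s * (e / (s * s))"
      using e unfolding real_sqrt_mult[of "2 * pi"] s_def[symmetric] unfolding s(2) by simp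
    also have "\<dots> = e / s"
      using s(1) by simp
    finally have 1: "sqrt (2 * pi * (e / (2 * pi))\<^sup>2) = e / s" .
    have 2: "- t\<^sup>2 / 2 = - (v - 0)\<^sup>2 / (2 * (e / (2 * pi))\<^sup>2)"
      unfolding t_def power_divide power_mult_distrib diff_0_right using e by (simp add: field_simps)
    show ?thesis
      unfolding normal_density_def 1 2[symmetric] using e s(1) by simp
  qed
  moreover have "s *\<^sub>R (complex_of_real (exp (- t\<^sup>2 / 2)) /\<^sub>R \<bar>e\<bar>)
      = complex_of_real (s * (exp (- t\<^sup>2 / 2) / e))"
    unfolding scaleR_conv_of_real divide_inverse of_real_mult using e by simp
  ultimately show ?thesis by (simp only:)
qed

lemma has_bochner_integral_gauss_cos_sin:
  fixes v e :: real
  assumes e: "0 < e"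
  shows "has_bochner_integral lborel (\<lambda>x. exp (- (e * x)\<^sup>2 / 2) * cos (2 * pi * v * x))
           (normal_density 0 (e / (2 * pi)) v)"
    and "has_bochner_integral lborel (\<lambda>x. exp (- (e * x)\<^sup>2 / 2) * sin (2 * pi * v * x)) 0"
  using has_bochner_integral_Re[OF has_bochner_integral_gauss_iexp[OF e, of v]]
    has_bochner_integral_Im[OF has_bochner_integral_gauss_iexp[OF e, of v]]
  by (simp_all add: Re_exp Im_exp)

lemma Basis_real2: "(Basis :: (real ^ 2) set) = {axis 1 1, axis 2 1}"
  by (auto simp: Basis_vec_def UNIV_2)

text \<open>Fubini for separated variables. \<open>lborel\<close> on the plane is the image of a
  product of line measures indexed by \<open>Basis\<close>, so each basis vector is assigned its own
  factor and the product rule for finite families applies.\<close>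

lemma has_bochner_integral_lborel_real2:
  fixes a b :: "real \<Rightarrow> real"
  assumes "has_bochner_integral lborel a A" "has_bochner_integral lborel b B"
  shows "has_bochner_integral lborel (\<lambda>x::real^2. a (x $ 1) * b (x $ 2)) (A * B)"
proof -
  let ?F = "\<lambda>i::real^2. if i = axis 1 1 then a else b"
  interpret product_sigma_finite "\<lambda>_::real^2. lborel::real measure" ..
  have ne: "axis 1 1 \<noteq> (axis 2 1 :: real^2)"
    by (simp add: axis_eq_axis)
  have int: "integrable lborel (?F i)" for i
    using assms by (auto simp: has_bochner_integral_iff)
  have [measurable]: "a \<in> borel_measurable borel" "b \<in> borel_measurable borel"
    using assms by (auto simp: has_bochner_integral_iff dest: borel_measurable_integrable)
  have "has_bochner_integral (\<Pi>\<^sub>M i\<in>(Basis :: (real^2) set). lborel) (\<lambda>x. \<Prod>i\<in>Basis. ?F i (x i))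
      (\<Prod>i\<in>(Basis :: (real^2) set). integral\<^sup>L lborel (?F i))"
    unfolding has_bochner_integral_iff
    by (intro conjI product_integrable_prod product_integral_prod int finite_Basis)
  also have "(\<Prod>i\<in>(Basis :: (real^2) set). integral\<^sup>L lborel (?F i)) = A * B"
    using assms ne by (simp add: Basis_real2 has_bochner_integral_iff)
  also have "(\<lambda>x. \<Prod>i\<in>(Basis :: (real^2) set). ?F i (x i)) =
      (\<lambda>x. (\<lambda>y::real^2. a (y $ 1) * b (y $ 2)) (\<Sum>i\<in>Basis. x i *\<^sub>R i))"
  proof
    fix x :: "real^2 \<Rightarrow> real"
    have "(\<Sum>i\<in>Basis. x i *\<^sub>R i) $ 1 = x (axis 1 1)" "(\<Sum>i\<in>Basis. x i *\<^sub>R i) $ 2 = x (axis 2 1)"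
      using ne by (simp_all add: Basis_real2) (simp_all add: axis_def)
    moreover have "(\<Prod>i\<in>(Basis :: (real^2) set). ?F i (x i)) = a (x (axis 1 1)) * b (x (axis 2 1))"
      using ne by (simp add: Basis_real2)
    ultimately show "(\<Prod>i\<in>(Basis :: (real^2) set). ?F i (x i)) =
      (\<lambda>y::real^2. a (y $ 1) * b (y $ 2)) (\<Sum>i\<in>Basis. x i *\<^sub>R i)"
      by (simp only:)
  qed
  finally show ?thesis
    by (subst lborel_eq) (simp add: has_bochner_integral_distr)
qed

definition gauss_weight :: "real \<Rightarrow> real ^ 2 \<Rightarrow> real"
  where "gauss_weight e \<omega> = exp (- (e * \<omega> $ 1)\<^sup>2 / 2) * exp (- (e * \<omega> $ 2)\<^sup>2 / 2)"

text \<open>The Fourier transform of \<open>gauss_weight e\<close>. The weight makes frequency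
  integrals of bounded functions converge and increases to 1 as \<open>e\<close> decreases to 0,
  while this kernel is a probability density concentrating at the origin.\<close>

definition gauss_kernel :: "real \<Rightarrow> real ^ 2 \<Rightarrow> real"
  where "gauss_kernel e v =
    normal_density 0 (e / (2 * pi)) (v $ 1) * normal_density 0 (e / (2 * pi)) (v $ 2)"

text \<open>
  Expanding the two exponentials, the products involving a sine are odd in one frequency variable
  and vanish, so that non-commutativity plays no role.
\<close>

lemma has_bochner_integral_gauss_qker:
  assumes e: "0 < e"
  shows "has_bochner_integral lborel (\<lambda>\<omega>. gauss_weight e \<omega> *\<^sub>R qker \<omega> v q) (gauss_kernel e v *\<^sub>R q)"
proof -
  note c = has_bochner_integral_gauss_cos_sin(1)[OF e] and s = has_bochner_integral_gauss_cos_sin(2)[OF e]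
  let ?E = "\<lambda>z::real. exp (- (e * z)\<^sup>2 / 2)"
  let ?c = "\<lambda>i \<omega>. ?E (\<omega> $ i) * cos (2 * pi * v $ i * \<omega> $ i)"
  let ?s = "\<lambda>i \<omega>. ?E (\<omega> $ i) * sin (2 * pi * v $ i * \<omega> $ i)"
  have eq: "gauss_weight e \<omega> *\<^sub>R qker \<omega> v q =
      (?c 1 \<omega> * ?c 2 \<omega>) *\<^sub>R q - (?s 1 \<omega> * ?c 2 \<omega>) *\<^sub>R (quat_i * q)
      - (?c 1 \<omega> * ?s 2 \<omega>) *\<^sub>R (q * quat_j) + (?s 1 \<omega> * ?s 2 \<omega>) *\<^sub>R (quat_i * q * quat_j)" for \<omega>
    unfolding gauss_weight_def qker_trig
    by (simp add: algebra_simps)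
  have "has_bochner_integral lborel (\<lambda>\<omega>::real^2. gauss_weight e \<omega> *\<^sub>R qker \<omega> v q)
      ((normal_density 0 (e / (2 * pi)) (v $ 1) * normal_density 0 (e / (2 * pi)) (v $ 2)) *\<^sub>R q
       - (0 * normal_density 0 (e / (2 * pi)) (v $ 2)) *\<^sub>R (quat_i * q)
       - (normal_density 0 (e / (2 * pi)) (v $ 1) * 0) *\<^sub>R (q * quat_j) + (0 * 0) *\<^sub>R (quat_i * q * quat_j))"
    unfolding eq
    by (intro has_bochner_integral_add has_bochner_integral_diff has_bochner_integral_scaleR_left
        has_bochner_integral_lborel_real2 c s)
  then show ?thesis
    by (simp add: gauss_kernel_def)
qed

lemma gauss_weight_nonneg [simp]: "0 \<le> gauss_weight e \<omega>"
  by (simp add: gauss_weight_def)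

lemma gauss_kernel_nonneg [simp]: "0 \<le> gauss_kernel e v"
  by (simp add: gauss_kernel_def)

lemma borel_measurable_gauss_weight [measurable]: "gauss_weight e \<in> borel_measurable borel"
  unfolding gauss_weight_def by measurable

lemma borel_measurable_gauss_kernel [measurable]: "gauss_kernel e \<in> borel_measurable borel"
  unfolding gauss_kernel_def by measurable

lemma integrable_gauss_weight:
  assumes "0 < e"
  shows "integrable lborel (gauss_weight e)"
  using has_bochner_integral_lborel_real2[OF has_bochner_integral_gauss_cos_sin(1)[OF assms, of 0]
      has_bochner_integral_gauss_cos_sin(1)[OF assms, of 0]]
  by (simp add: has_bochner_integral_iff gauss_weight_def[abs_def])

lemma has_bochner_integral_gauss_kernel:
  assumes "0 < e"
  shows "has_bochner_integral lborel (gauss_kernel e) 1"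
proof -
  have "has_bochner_integral lborel (normal_density 0 (e / (2 * pi))) 1"
    using assms by (simp add: has_bochner_integral_iff)
  from has_bochner_integral_lborel_real2[OF this this] show ?thesis
    by (simp add: gauss_kernel_def[abs_def])
qed

text \<open>The sum of the two coordinate variances; its decay as \<open>e\<close> tends to 0
  measures the concentration of the kernel.\<close>

lemma has_bochner_integral_gauss_kernel_square:
  assumes "0 < e"
  shows "has_bochner_integral lborel (\<lambda>v. gauss_kernel e v * (norm v)\<^sup>2) (2 * (e / (2 * pi))\<^sup>2)"
proof -
  let ?n = "normal_density 0 (e / (2 * pi))"
  have 1: "has_bochner_integral lborel ?n 1"
    using assms by (simp add: has_bochner_integral_iff)
  have 2: "has_bochner_integral lborel (\<lambda>x. ?n x * x\<^sup>2) ((e / (2 * pi))\<^sup>2)"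
    using normal_moment_even[of "e / (2 * pi)" 0 1] assms by simp
  have "gauss_kernel e v * (norm v)\<^sup>2 =
      (?n (v $ 1) * (v $ 1)\<^sup>2) * ?n (v $ 2) + ?n (v $ 1) * (?n (v $ 2) * (v $ 2)\<^sup>2)" for v
    by (simp add: gauss_kernel_def norm_vec_def L2_set_def sum_2 algebra_simps)
  then show ?thesis
    using has_bochner_integral_add[OF has_bochner_integral_lborel_real2[OF 2 1]
        has_bochner_integral_lborel_real2[OF 1 2]]
    by simp
qed

text \<open>A Chebyshev argument in place of tail estimates: \<open>D\<close> is below
  \<open>r / 2\<close> within distance \<open>d\<close> of 0 and at most \<open>C\<close> elsewhere,
  so \<open>r / 2\<close> plus \<open>C / d\<^sup>2\<close> times the squared distance bounds it
  everywhere, and the second moment of the kernel tends to 0.\<close>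

lemma gauss_kernel_approx_identity:
  fixes D :: "real ^ 2 \<Rightarrow> real"
  assumes [measurable]: "D \<in> borel_measurable borel"
    and nn: "\<And>v. 0 \<le> D v" and C: "\<And>v. D v \<le> C" and D0: "(D \<longlongrightarrow> 0) (at 0)" "D 0 = 0"
    and e: "\<And>n. 0 < e n" "e \<longlonglongrightarrow> 0"
  shows "(\<lambda>n. LINT v|lborel. gauss_kernel (e n) v * D v) \<longlonglongrightarrow> 0"
proof (rule LIMSEQ_I)
  fix r :: real assume r: "0 < r"
  obtain d where d: "d > 0" "\<And>v. norm v < d \<Longrightarrow> D v < r / 2"
  proof -
    have "\<exists>d>0. \<forall>v. v \<noteq> 0 \<and> norm (v - 0) < d \<longrightarrow> norm (D v - 0) < r / 2"
      using LIM_D[OF D0(1), of "r / 2"] r by simp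
    then obtain d where d: "d > 0" "\<And>v. v \<noteq> 0 \<Longrightarrow> norm v < d \<Longrightarrow> \<bar>D v\<bar> < r / 2"
      by auto
    have "D v < r / 2" if "norm v < d" for v
      using d(2)[of v] that r D0(2) by (cases "v = 0") auto
    with d(1) show thesis by (rule that)
  qed
  have C0: "0 \<le> C" using nn[of 0] C[of 0] by simp
  have bd: "D v \<le> r / 2 + C / d\<^sup>2 * (norm v)\<^sup>2" for v
  proof (cases "norm v < d")
    case True
    then have "D v \<le> r / 2" using d(2)[of v] by simp
    moreover have "0 \<le> C / d\<^sup>2 * (norm v)\<^sup>2" using C0 by simp
    ultimately show ?thesis by linarith
  next
    case False
    then have "d\<^sup>2 \<le> (norm v)\<^sup>2" using d(1) by (intro power_mono) auto
    then have "C * 1 \<le> C * ((norm v)\<^sup>2 / d\<^sup>2)"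
      using C0 d(1) by (intro mult_left_mono) (simp_all add: field_simps)
    then show ?thesis using C[of v] r by simp
  qed
  have "(\<lambda>n. C / d\<^sup>2 * (2 * (e n / (2 * pi))\<^sup>2)) \<longlonglongrightarrow> C / d\<^sup>2 * (2 * (0 / (2 * pi))\<^sup>2)"
    by (intro tendsto_intros e) simp
  then have "\<forall>\<^sub>F n in sequentially. C / d\<^sup>2 * (2 * (e n / (2 * pi))\<^sup>2) < r / 2"
    using r by (intro order_tendstoD(2)) auto
  then obtain N where N: "\<And>n. n \<ge> N \<Longrightarrow> C / d\<^sup>2 * (2 * (e n / (2 * pi))\<^sup>2) < r / 2"
    by (auto simp: eventually_sequentially)
  show "\<exists>N. \<forall>n\<ge>N. norm ((LINT v|lborel. gauss_kernel (e n) v * D v) - 0) < r"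
  proof (intro exI allI impI)
    fix n assume n: "N \<le> n"
    note k = has_bochner_integral_gauss_kernel[OF e(1)[of n]]
    have h: "has_bochner_integral lborel
       (\<lambda>v. r / 2 * gauss_kernel (e n) v + C / d\<^sup>2 * (gauss_kernel (e n) v * (norm v)\<^sup>2))
       (r / 2 * 1 + C / d\<^sup>2 * (2 * (e n / (2 * pi))\<^sup>2))"
      by (intro has_bochner_integral_add has_bochner_integral_mult_right k
          has_bochner_integral_gauss_kernel_square e)
    have le: "gauss_kernel (e n) v * D v
        \<le> r / 2 * gauss_kernel (e n) v + C / d\<^sup>2 * (gauss_kernel (e n) v * (norm v)\<^sup>2)" for v
      using mult_left_mono[OF bd[of v] gauss_kernel_nonneg[of "e n" v]] by (simp add: algebra_simps)
    have "(LINT v|lborel. gauss_kernel (e n) v * D v) \<le> r / 2 * 1 + C / d\<^sup>2 * (2 * (e n / (2 * pi))\<^sup>2)"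
      unfolding has_bochner_integral_integral_eq[OF h, symmetric]
    proof (rule integral_mono')
      show "0 \<le> r / 2 * gauss_kernel (e n) v + C / d\<^sup>2 * (gauss_kernel (e n) v * (norm v)\<^sup>2)" for v
        using C0 r by simp
    qed (use h in \<open>simp add: has_bochner_integral_iff\<close>, rule le)
    also have "\<dots> < r" using N[OF n] by simp
    finally show "norm ((LINT v|lborel. gauss_kernel (e n) v * D v) - 0) < r"
      using nn by simp
  qed
qed

section \<open>Continuity of translations in mean square\<close>

lemma lborel_distr_shift: "distr lborel borel (\<lambda>x. x + c) = (lborel :: 'a::euclidean_space measure)"
proof -
  have "(+) c = (\<lambda>x. x + c)" by (simp add: fun_eq_iff add.commute)
  then show ?thesis using lborel_distr_plus[of c] by simp
qed

lemma lborel_distr_reflect: "distr lborel borel (\<lambda>x. c - x) = (lborel :: 'a::euclidean_space measure)"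
  using lborel_affine[of "-1" c] by (simp add: density_1)

lemma
  fixes f :: "'a::euclidean_space \<Rightarrow> 'b::{banach,second_countable_topology}"
  assumes [measurable]: "f \<in> borel_measurable borel"
  shows integral_lborel_shift: "(LINT x|lborel. f (x + c)) = (LINT x|lborel. f x)"
    and integrable_lborel_shift: "integrable lborel (\<lambda>x. f (x + c)) \<longleftrightarrow> integrable lborel f"
    and integral_lborel_reflect: "(LINT x|lborel. f (c - x)) = (LINT x|lborel. f x)"
    and integrable_lborel_reflect: "integrable lborel (\<lambda>x. f (c - x)) \<longleftrightarrow> integrable lborel f"
proof -
  show "(LINT x|lborel. f (x + c)) = (LINT x|lborel. f x)"
    by (subst (2) lborel_distr_shift[of c, symmetric], subst integral_distr) auto
  show "integrable lborel (\<lambda>x. f (x + c)) \<longleftrightarrow> integrable lborel f"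
    by (subst (2) lborel_distr_shift[of c, symmetric], subst integrable_distr_eq) auto
  show "(LINT x|lborel. f (c - x)) = (LINT x|lborel. f x)"
    by (subst (2) lborel_distr_reflect[of c, symmetric], subst integral_distr) auto
  show "integrable lborel (\<lambda>x. f (c - x)) \<longleftrightarrow> integrable lborel f"
    by (subst (2) lborel_distr_reflect[of c, symmetric], subst integrable_distr_eq) auto
qed

lemma norm_add_square_le:
  "(norm (a + b))\<^sup>2 \<le> 2 * (norm a)\<^sup>2 + 2 * (norm (b :: 'a::real_normed_vector))\<^sup>2"
proof -
  have "(norm (a + b))\<^sup>2 \<le> (norm a + norm b)\<^sup>2"
    by (intro power_mono norm_triangle_ineq) simp
  also have "\<dots> \<le> 2 * (norm a)\<^sup>2 + 2 * (norm b)\<^sup>2"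
    using sum_squares_bound[of "norm a" "norm b"] by (simp add: power2_sum)
  finally show ?thesis .
qed

lemma norm_diff_square_le:
  "(norm (a - b))\<^sup>2 \<le> 2 * (norm a)\<^sup>2 + 2 * (norm (b :: 'a::real_normed_vector))\<^sup>2"
  using norm_add_square_le[of a "- b"] by simp

lemma integrable_norm_diff_square:
  fixes f g :: "'a \<Rightarrow> 'b::{real_normed_vector,second_countable_topology}"
  assumes [measurable]: "f \<in> borel_measurable M" "g \<in> borel_measurable M"
    and "integrable M (\<lambda>x. (norm (f x))\<^sup>2)" "integrable M (\<lambda>x. (norm (g x))\<^sup>2)"
  shows "integrable M (\<lambda>x. (norm (f x - g x))\<^sup>2)"
proof (rule Bochner_Integration.integrable_bound)
  show "integrable M (\<lambda>x. 2 * (norm (f x))\<^sup>2 + 2 * (norm (g x))\<^sup>2)"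
    using assms by simp
qed (auto intro!: AE_I2 order_trans[OF norm_diff_square_le])

text \<open>A measurable function is an almost everywhere limit of continuous functions
  \<open>k n\<close>, but without a majorant. Cutting off in space by \<open>cut\<close> and in size
  by \<open>T\<close> supplies one. The cut-offs at level \<open>m\<close> are applied to
  \<open>h\<close> as well, so that for fixed \<open>m\<close> dominated convergence in
  \<open>n\<close> compares two functions bounded on the same ball.\<close>

lemma square_integrable_approx_continuous:
  fixes h :: "'a::euclidean_space \<Rightarrow> 'b::euclidean_space"
  assumes h[measurable]: "h \<in> borel_measurable borel"
    and h2: "integrable lborel (\<lambda>x. (norm (h x))\<^sup>2)" and r: "0 < r"
  obtains g R where "continuous_on UNIV g" "\<And>x. R \<le> norm x \<Longrightarrow> g x = 0"
    "integrable lborel (\<lambda>x. (norm (h x - g x))\<^sup>2)" "(LINT x|lborel. (norm (h x - g x))\<^sup>2) < r"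
proof -
  have "h measurable_on UNIV"
    by (rule lebesgue_measurable_imp_measurable_on) (auto intro: measurable_completion)
  then obtain N k where N: "negligible N" and k: "\<And>n. continuous_on UNIV (k n)"
    and lim: "\<And>x. x \<notin> N \<Longrightarrow> (\<lambda>n. k n x) \<longlonglongrightarrow> h x"
    unfolding measurable_on_def by auto
  have N_AE: "AE x in lborel. x \<notin> N"
  proof -
    have "AE x in lebesgue. x \<notin> N"
      using N by (simp add: negligible_iff_null_sets AE_not_in)
    then show ?thesis by (simp add: AE_completion_iff)
  qed
  define cut :: "nat \<Rightarrow> 'a \<Rightarrow> real" where "cut m x = max 0 (min 1 (real m + 1 - norm x))" for m x
  \<comment> \<open>The radial retraction onto the ball of radius \<open>m + 1\<close>; the
    denominator never falls below \<open>m + 1\<close>, so continuity at 0 is evident.\<close>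
  define T :: "nat \<Rightarrow> 'b \<Rightarrow> 'b" where "T m y = ((real m + 1) / max (real m + 1) (norm y)) *\<^sub>R y" for m y
  have cut: "0 \<le> cut m x" "cut m x \<le> 1" "real m + 1 \<le> norm x \<Longrightarrow> cut m x = 0" "norm x \<le> real m \<Longrightarrow> cut m x = 1" for m x
    by (auto simp: cut_def)
  have ccut: "continuous_on UNIV (cut m)" for m
    unfolding cut_def by (intro continuous_intros)
  have cT: "continuous_on UNIV (T m)" for m
    unfolding T_def by (intro continuous_intros) auto
  have [measurable]: "cut m \<in> borel_measurable borel" "T m \<in> borel_measurable borel" "k m \<in> borel_measurable borel" for m
    using ccut cT k by (auto intro: borel_measurable_continuous_onI)
  have T1: "norm (T m y) \<le> real m + 1" for m y
    by (simp add: T_def divide_simps max_def)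
  have T2: "norm (T m y) \<le> norm y" for m y
  proof -
    have "(real m + 1) / max (real m + 1) (norm y) \<le> 1" by simp
    then have "(real m + 1) / max (real m + 1) (norm y) * norm y \<le> 1 * norm y"
      by (intro mult_right_mono) auto
    moreover have "norm (T m y) = (real m + 1) / max (real m + 1) (norm y) * norm y"
      by (simp add: T_def)
    ultimately show ?thesis by simp
  qed
  have T3: "T m y = y" if "norm y \<le> real m" for m y
    using that by (simp add: T_def max_def)
  let ?h = "\<lambda>(m::nat) (x::'a). cut m x *\<^sub>R T m (h x)"
  let ?g = "\<lambda>(m::nat) (n::nat) (x::'a). cut m x *\<^sub>R T m (k n x)"
  have hb: "norm (?h m x) \<le> norm (h x)" for m x
    using mult_mono[OF cut(2)[of m x] T2[of m "h x"]] cut(1)[of m x] by simp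
  have sq: "integrable lborel (\<lambda>x. (norm (?h m x))\<^sup>2)" for m
    by (rule Bochner_Integration.integrable_bound[OF h2]) (use hb in \<open>auto intro!: power_mono\<close>)
  have "(\<lambda>m. LINT x|lborel. (norm (h x - ?h m x))\<^sup>2) \<longlonglongrightarrow> (LINT x|(lborel::'a measure). 0)"
  proof (rule integral_dominated_convergence)
    show "integrable lborel (\<lambda>x. 4 * (norm (h x))\<^sup>2)" using h2 by simp
    show "AE x in lborel. norm ((norm (h x - ?h m x))\<^sup>2) \<le> 4 * (norm (h x))\<^sup>2" for m
    proof (rule AE_I2)
      fix x
      have "(norm (?h m x))\<^sup>2 \<le> (norm (h x))\<^sup>2" by (intro power_mono hb) simp
      then show "norm ((norm (h x - ?h m x))\<^sup>2) \<le> 4 * (norm (h x))\<^sup>2"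
        using norm_diff_square_le[of "h x" "?h m x"] unfolding real_norm_def abs_power2 by linarith
    qed
    show "AE x in lborel. (\<lambda>m. (norm (h x - ?h m x))\<^sup>2) \<longlonglongrightarrow> 0"
    proof (rule AE_I2, rule tendsto_eventually)
      fix x
      obtain M where M: "max (norm x) (norm (h x)) \<le> real M" using real_arch_simple by blast
      show "\<forall>\<^sub>F m in sequentially. (norm (h x - ?h m x))\<^sup>2 = 0"
      proof (rule eventually_sequentiallyI)
        fix m assume "M \<le> m"
        then have "norm x \<le> real m" "norm (h x) \<le> real m" using M by auto
        then show "(norm (h x - ?h m x))\<^sup>2 = 0" by (simp add: cut(4) T3)
      qed
    qed
  qed auto
  \<comment> \<open>Two errors below \<open>r / 4\<close> suffice, as the square of a sum costs a
    factor 2 on each term.\<close>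
  then obtain m where m: "(LINT x|lborel. (norm (h x - ?h m x))\<^sup>2) < r / 4"
    using order_tendstoD(2)[of _ "0::real" sequentially "r / 4"] r eventually_happens[of _ sequentially]
    by fastforce
  let ?B = "\<lambda>x::'a. indicator (cball 0 (real m + 1)) x :: real"
  have intB: "integrable lborel ?B"
    by (rule integrable_real_indicator) (auto intro!: emeasure_bounded_finite simp flip: infinity_ennreal_def)
  have gb: "norm (cut m x *\<^sub>R T m y) \<le> (real m + 1) * ?B x" for x y
  proof (cases "norm x \<le> real m + 1")
    case True
    then show ?thesis using mult_mono[OF cut(2)[of m x] T1[of m y]] cut(1)[of m x] by simp
  next
    case False
    then show ?thesis using cut(3)[of m x] by simp
  qed
  have gb2: "(norm (cut m x *\<^sub>R T m y))\<^sup>2 \<le> (real m + 1)\<^sup>2 * ?B x" for x y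
  proof -
    have "(norm (cut m x *\<^sub>R T m y))\<^sup>2 \<le> ((real m + 1) * ?B x)\<^sup>2" by (intro power_mono gb) simp
    also have "\<dots> = (real m + 1)\<^sup>2 * ?B x" by (simp add: indicator_def)
    finally show ?thesis .
  qed
  have gsq: "integrable lborel (\<lambda>x. (norm (?g m n x))\<^sup>2)" for n
    by (rule Bochner_Integration.integrable_bound[OF integrable_mult_right[OF intB, of "(real m + 1)\<^sup>2"]])
       (use gb2 in auto)
  have "(\<lambda>n. LINT x|lborel. (norm (?h m x - ?g m n x))\<^sup>2) \<longlonglongrightarrow> (LINT x|(lborel::'a measure). 0)"
  proof (rule integral_dominated_convergence)
    show "integrable lborel (\<lambda>x. 4 * ((real m + 1)\<^sup>2 * ?B x))" using intB by simp
    show "AE x in lborel. norm ((norm (?h m x - ?g m n x))\<^sup>2) \<le> 4 * ((real m + 1)\<^sup>2 * ?B x)" for n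
    proof (rule AE_I2)
      fix x
      show "norm ((norm (?h m x - ?g m n x))\<^sup>2) \<le> 4 * ((real m + 1)\<^sup>2 * ?B x)"
        using norm_diff_square_le[of "?h m x" "?g m n x"] gb2[of x "h x"] gb2[of x "k n x"]
        unfolding real_norm_def abs_power2 by linarith
    qed
    show "AE x in lborel. (\<lambda>n. (norm (?h m x - ?g m n x))\<^sup>2) \<longlonglongrightarrow> 0"
      using N_AE
    proof eventually_elim
      case (elim x)
      have "isCont (T m) (h x)" using cT by (simp add: continuous_on_eq_continuous_at)
      then have "(\<lambda>n. T m (k n x)) \<longlonglongrightarrow> T m (h x)"
        using lim[OF elim] by (rule isCont_tendsto_compose)
      then have "(\<lambda>n. (norm (?h m x - ?g m n x))\<^sup>2) \<longlonglongrightarrow> (norm (?h m x - ?h m x))\<^sup>2"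
        by (intro tendsto_intros)
      then show ?case by simp
    qed
  qed auto
  then obtain n where n: "(LINT x|lborel. (norm (?h m x - ?g m n x))\<^sup>2) < r / 4"
    using order_tendstoD(2)[of _ "0::real" sequentially "r / 4"] r eventually_happens[of _ sequentially]
    by fastforce
  have i1: "integrable lborel (\<lambda>x. (norm (h x - ?h m x))\<^sup>2)"
    by (rule integrable_norm_diff_square) (use h2 sq in auto)
  have i2: "integrable lborel (\<lambda>x. (norm (?h m x - ?g m n x))\<^sup>2)"
    by (rule integrable_norm_diff_square[OF _ _ sq gsq]) auto
  have i3: "integrable lborel (\<lambda>x. (norm (h x - ?g m n x))\<^sup>2)"
    by (rule integrable_norm_diff_square[OF _ _ h2 gsq]) auto
  show thesis
  proof (rule that[of "?g m n" "real m + 1"])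
    show "continuous_on UNIV (?g m n)"
      by (intro continuous_intros ccut continuous_on_compose2[OF cT k]) auto
    show "?g m n x = 0" if "real m + 1 \<le> norm x" for x
      using cut(3)[OF that] by simp
    show "integrable lborel (\<lambda>x. (norm (h x - ?g m n x))\<^sup>2)" by (rule i3)
    have "(LINT x|lborel. (norm (h x - ?g m n x))\<^sup>2)
        \<le> (LINT x|lborel. 2 * (norm (h x - ?h m x))\<^sup>2 + 2 * (norm (?h m x - ?g m n x))\<^sup>2)"
    proof (rule integral_mono[OF i3])
      show "(norm (h x - ?g m n x))\<^sup>2 \<le> 2 * (norm (h x - ?h m x))\<^sup>2 + 2 * (norm (?h m x - ?g m n x))\<^sup>2" for x
        using norm_add_square_le[of "h x - ?h m x" "?h m x - ?g m n x"] by simp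
    qed (use i1 i2 in simp)
    also have "\<dots> = 2 * (LINT x|lborel. (norm (h x - ?h m x))\<^sup>2) + 2 * (LINT x|lborel. (norm (?h m x - ?g m n x))\<^sup>2)"
      using i1 i2 by simp
    also have "\<dots> < r" using m n by simp
    finally show "(LINT x|lborel. (norm (h x - ?g m n x))\<^sup>2) < r" .
  qed
qed

text \<open>Along a sequence of shifts of norm at most \<open>K\<close> all the differences vanish
  outside the ball of radius \<open>R + K\<close> and are uniformly bounded, so pointwise continuity
  of \<open>g\<close> passes to the integrals.\<close>

lemma translation_continuous_compact_support:
  fixes g :: "'a::euclidean_space \<Rightarrow> 'b::euclidean_space"
  assumes g: "continuous_on UNIV g" and R: "\<And>x. R \<le> norm x \<Longrightarrow> g x = 0"
  shows "((\<lambda>v. LINT x|lborel. (norm (g x - g (x + v)))\<^sup>2) \<longlongrightarrow> 0) (at 0)"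
  unfolding tendsto_at_iff_sequentially comp_def
proof (intro allI impI)
  fix X :: "nat \<Rightarrow> 'a" assume X: "X \<longlonglongrightarrow> 0"
  have [measurable]: "g \<in> borel_measurable borel"
    using g by (rule borel_measurable_continuous_onI)
  have "bounded (g ` cball 0 R)"
    by (intro compact_imp_bounded compact_continuous_image continuous_on_subset[OF g]) auto
  then obtain B where B: "0 < B" "\<And>x. norm x \<le> R \<Longrightarrow> norm (g x) \<le> B"
    unfolding bounded_pos by (auto simp: image_iff)
  then have B: "norm (g x) \<le> B" for x
    using R[of x] by (cases "norm x \<le> R") auto
  have "bounded (range X)" using X by (intro convergent_imp_bounded)
  then obtain K where K: "\<And>n. norm (X n) \<le> K" by (auto simp: bounded_iff)
  have K0: "0 \<le> K" using norm_ge_zero[of "X 0"] K[of 0] by linarith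
  let ?I = "\<lambda>x::'a. indicator (cball 0 (R + K)) x :: real"
  have intI: "integrable lborel ?I"
    by (rule integrable_real_indicator) (auto intro!: emeasure_bounded_finite simp flip: infinity_ennreal_def)
  have "(\<lambda>n. LINT x|lborel. (norm (g x - g (x + X n)))\<^sup>2) \<longlonglongrightarrow> (LINT x|(lborel::'a measure). 0)"
  proof (rule integral_dominated_convergence)
    show "integrable lborel (\<lambda>x. 4 * B\<^sup>2 * ?I x)" using intI by simp
    show "AE x in lborel. norm ((norm (g x - g (x + X n)))\<^sup>2) \<le> 4 * B\<^sup>2 * ?I x" for n
    proof (rule AE_I2)
      fix x
      have b: "(norm (g y))\<^sup>2 \<le> B\<^sup>2" for y using B by (intro power_mono) auto
      show "norm ((norm (g x - g (x + X n)))\<^sup>2) \<le> 4 * B\<^sup>2 * ?I x"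
      proof (cases "norm x \<le> R + K")
        case True
        have "(norm (g x - g (x + X n)))\<^sup>2 \<le> 4 * B\<^sup>2"
          using norm_diff_square_le[of "g x" "g (x + X n)"] b[of x] b[of "x + X n"] by linarith
        then show ?thesis using True by simp
      next
        case False
        have "norm x \<le> norm (x + X n) + norm (X n)"
          using norm_triangle_ineq4[of "x + X n" "X n"] by simp
        then have "R \<le> norm (x + X n)" "R \<le> norm x" using False K[of n] K0 by linarith+
        then show ?thesis using False by (simp add: R)
      qed
    qed
    show "AE x in lborel. (\<lambda>n. (norm (g x - g (x + X n)))\<^sup>2) \<longlonglongrightarrow> 0"
    proof (rule AE_I2)
      fix x
      have "isCont g x" using g by (simp add: continuous_on_eq_continuous_at)
      moreover have "(\<lambda>n. x + X n) \<longlonglongrightarrow> x" using tendsto_add[OF tendsto_const X, of x] by simp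
      ultimately have "(\<lambda>n. g (x + X n)) \<longlonglongrightarrow> g x" by (rule isCont_tendsto_compose)
      then have "(\<lambda>n. (norm (g x - g (x + X n)))\<^sup>2) \<longlonglongrightarrow> (norm (g x - g x))\<^sup>2"
        by (intro tendsto_intros)
      then show "(\<lambda>n. (norm (g x - g (x + X n)))\<^sup>2) \<longlonglongrightarrow> 0" by simp
    qed
  qed auto
  then show "(\<lambda>n. LINT x|lborel. (norm (g x - g (x + X n)))\<^sup>2) \<longlonglongrightarrow> 0" by simp
qed

lemma translation_continuous_L2:
  fixes h :: "'a::euclidean_space \<Rightarrow> 'b::euclidean_space"
  assumes [measurable]: "h \<in> borel_measurable borel"
    and h2: "integrable lborel (\<lambda>x. (norm (h x))\<^sup>2)"
  shows "((\<lambda>v. LINT x|lborel. (norm (h x - h (x + v)))\<^sup>2) \<longlongrightarrow> 0) (at 0)"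
proof (rule tendstoI)
  fix r :: real assume r: "0 < r"
  \<comment> \<open>Applying the bound for the square of a sum twice gives the weights 4, 4 and 2
    used below. The errors \<open>r / 12\<close>, \<open>r / 12\<close> (by translation invariance)
    and \<open>r / 6\<close> then contribute \<open>r / 3\<close> each.\<close>
  obtain g R where g: "continuous_on UNIV g" "\<And>x. R \<le> norm x \<Longrightarrow> g x = 0"
    "integrable lborel (\<lambda>x. (norm (h x - g x))\<^sup>2)" "(LINT x|lborel. (norm (h x - g x))\<^sup>2) < r / 12"
    using square_integrable_approx_continuous[OF assms, of "r / 12"] r by auto
  have [measurable]: "g \<in> borel_measurable borel"
    using g(1) by (rule borel_measurable_continuous_onI)
  have g2: "integrable lborel (\<lambda>x. (norm (g x))\<^sup>2)"
    using integrable_norm_diff_square[OF _ _ h2 g(3)] by simp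
  have "\<forall>\<^sub>F v in at 0. (LINT x|lborel. (norm (g x - g (x + v)))\<^sup>2) < r / 6"
    using r by (intro order_tendstoD(2)[OF translation_continuous_compact_support[OF g(1,2)]]) auto
  then show "\<forall>\<^sub>F v in at 0. dist (LINT x|lborel. (norm (h x - h (x + v)))\<^sup>2) 0 < r"
  proof eventually_elim
    case (elim v)
    have s: "integrable lborel (\<lambda>x. (norm (h (x + v)))\<^sup>2)" "integrable lborel (\<lambda>x. (norm (g (x + v)))\<^sup>2)"
      "integrable lborel (\<lambda>x. (norm (h (x + v) - g (x + v)))\<^sup>2)"
      using integrable_lborel_shift[of "\<lambda>x. (norm (h x))\<^sup>2" v] integrable_lborel_shift[of "\<lambda>x. (norm (g x))\<^sup>2" v]
        integrable_lborel_shift[of "\<lambda>x. (norm (h x - g x))\<^sup>2" v] h2 g2 g(3) by auto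
    have gg: "integrable lborel (\<lambda>x. (norm (g x - g (x + v)))\<^sup>2)"
      by (rule integrable_norm_diff_square[OF _ _ g2 s(2)]) auto
    have "(LINT x|lborel. (norm (h x - h (x + v)))\<^sup>2) \<le> (LINT x|lborel. 4 * (norm (h x - g x))\<^sup>2
        + 4 * (norm (h (x + v) - g (x + v)))\<^sup>2 + 2 * (norm (g x - g (x + v)))\<^sup>2)"
    proof (rule integral_mono)
      show "integrable lborel (\<lambda>x. (norm (h x - h (x + v)))\<^sup>2)"
        by (rule integrable_norm_diff_square[OF _ _ h2 s(1)]) auto
      show "integrable lborel (\<lambda>x. 4 * (norm (h x - g x))\<^sup>2
        + 4 * (norm (h (x + v) - g (x + v)))\<^sup>2 + 2 * (norm (g x - g (x + v)))\<^sup>2)"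
        using g(3) s(3) gg by simp
      show "(norm (h x - h (x + v)))\<^sup>2 \<le> 4 * (norm (h x - g x))\<^sup>2
        + 4 * (norm (h (x + v) - g (x + v)))\<^sup>2 + 2 * (norm (g x - g (x + v)))\<^sup>2" for x
        using norm_add_square_le[of "(h x - g x) - (h (x + v) - g (x + v))" "g x - g (x + v)"]
          norm_diff_square_le[of "h x - g x" "h (x + v) - g (x + v)"] by simp
    qed
    also have "\<dots> = 4 * (LINT x|lborel. (norm (h x - g x))\<^sup>2)
        + 4 * (LINT x|lborel. (norm (h (x + v) - g (x + v)))\<^sup>2) + 2 * (LINT x|lborel. (norm (g x - g (x + v)))\<^sup>2)"
      using g(3) s(3) gg by simp
    also have "(LINT x|lborel. (norm (h (x + v) - g (x + v)))\<^sup>2) = (LINT x|lborel. (norm (h x - g x))\<^sup>2)"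
      by (rule integral_lborel_shift[of "\<lambda>x. (norm (h x - g x))\<^sup>2" v]) auto
    finally show ?case using g(4) elim by simp
  qed
qed

section \<open>The Plancherel theorem\<close>

text \<open>Taken over \<open>lborel\<close>, where joint measurability on product spaces is
  available; the completed measure of \<open>gqft\<close> is reached only at the end.\<close>

definition qft :: "(real ^ 2 \<Rightarrow> quat) \<Rightarrow> real ^ 2 \<Rightarrow> quat"
  where "qft h \<omega> = (LINT x|lborel. qker \<omega> x (h x))"

lemma borel_measurable_qft [measurable]:
  assumes [measurable]: "h \<in> borel_measurable borel"
  shows "qft h \<in> borel_measurable borel"
  unfolding qft_def by measurable

lemma integrable_qker:
  assumes "integrable lborel h"
  shows "integrable lborel (\<lambda>x. qker \<omega> x (h x))"
  by (rule Bochner_Integration.integrable_bound[OF assms]) (use assms in auto)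

lemma norm_qft_le:
  assumes "integrable lborel h"
  shows "norm (qft h \<omega>) \<le> (LINT x|lborel. norm (h x))"
  unfolding qft_def using integral_norm_bound[of lborel "\<lambda>x. qker \<omega> x (h x)"] by simp

text \<open>By translation invariance the integral over \<open>v\<close> is the norm of
  \<open>h x\<close> times the L1 norm of \<open>h\<close>, so the total is the square of that L1
  norm.\<close>

lemma integrable_autocorrelation:
  fixes h :: "real ^ 2 \<Rightarrow> quat"
  assumes h: "integrable lborel h"
  shows "integrable (lborel \<Otimes>\<^sub>M lborel) (\<lambda>(x, v). norm (h x) * norm (h (v + x)))"
proof (rule lborel_pair.Fubini_integrable)
  have [measurable]: "h \<in> borel_measurable borel" using h by auto
  show "(\<lambda>(x, v). norm (h x) * norm (h (v + x))) \<in> borel_measurable (lborel \<Otimes>\<^sub>M lborel)"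
    by measurable
  have s: "integrable lborel (\<lambda>v. norm (h (v + x)))" for x
    using integrable_lborel_shift[of "\<lambda>x. norm (h x)" x] h by simp
  show "AE x in lborel. integrable lborel (\<lambda>v. case (x, v) of (x, v) \<Rightarrow> norm (h x) * norm (h (v + x)))"
    using s by simp
  have "(LINT v|lborel. norm (h (v + x))) = (LINT x|lborel. norm (h x))" for x
    using integral_lborel_shift[of "\<lambda>x. norm (h x)" x] by simp
  then show "integrable lborel (\<lambda>x. LINT v|lborel. norm (case (x, v) of (x, v) \<Rightarrow> norm (h x) * norm (h (v + x))))"
    using h by simp
qed

text \<open>With the second point written as \<open>v + x\<close>, the kernel at \<open>x\<close>
  acts on both arguments of the inner product and cancels, leaving only the difference
  \<open>v\<close>. The product measure prepares for exchanging the frequency integral with both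
  variables at once.\<close>

lemma norm_qft_square:
  assumes h: "integrable lborel h"
  shows "(norm (qft h \<omega>))\<^sup>2 =
    (LINT p|(lborel \<Otimes>\<^sub>M lborel). inner (h (fst p)) (qker \<omega> (snd p) (h (snd p + fst p))))"
proof -
  have [measurable]: "h \<in> borel_measurable borel" using h by auto
  note i = integrable_qker[OF h, of \<omega>]
  have "(norm (qft h \<omega>))\<^sup>2 = inner (LINT x|lborel. qker \<omega> x (h x)) (qft h \<omega>)"
    by (simp add: power2_norm_eq_inner qft_def)
  also have "\<dots> = (LINT x|lborel. inner (qker \<omega> x (h x)) (qft h \<omega>))"
    using i by simp
  also have "\<dots> = (LINT x|lborel. LINT v|lborel. inner (h x) (qker \<omega> v (h (v + x))))"
  proof (rule Bochner_Integration.integral_cong[OF refl])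
    fix x
    have "inner (qker \<omega> x (h x)) (qft h \<omega>) = (LINT y|lborel. inner (qker \<omega> x (h x)) (qker \<omega> y (h y)))"
      unfolding qft_def using i by simp
    also have "\<dots> = (LINT v|lborel. inner (qker \<omega> x (h x)) (qker \<omega> (v + x) (h (v + x))))"
      by (rule integral_lborel_shift[symmetric]) simp
    also have "\<dots> = (LINT v|lborel. inner (h x) (qker \<omega> v (h (v + x))))"
      by (simp only: add.commute[of _ x] inner_qker_shift)
    finally show "inner (qker \<omega> x (h x)) (qft h \<omega>) = (LINT v|lborel. inner (h x) (qker \<omega> v (h (v + x))))" .
  qed
  also have "\<dots> = (LINT p|(lborel \<Otimes>\<^sub>M lborel). inner (h (fst p)) (qker \<omega> (snd p) (h (snd p + fst p))))"
  proof (subst lborel_pair.integral_fst'[symmetric])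
    show "integrable (lborel \<Otimes>\<^sub>M lborel) (\<lambda>p. inner (h (fst p)) (qker \<omega> (snd p) (h (snd p + fst p))))"
    proof (rule Bochner_Integration.integrable_bound[OF integrable_autocorrelation[OF h]])
      show "AE p in lborel \<Otimes>\<^sub>M lborel. norm (inner (h (fst p)) (qker \<omega> (snd p) (h (snd p + fst p))))
          \<le> norm (case p of (x, v) \<Rightarrow> norm (h x) * norm (h (v + x)))"
        using Cauchy_Schwarz_ineq2[of "h x" "qker \<omega> v (h (v + x))" for x v]
        by (auto intro!: AE_I2 simp: case_prod_unfold)
    qed measurable
  qed simp
  finally show ?thesis .
qed

text \<open>The weight makes the triple integral absolutely convergent: its majorant is the
  integrable autocorrelation bound times \<open>gauss_weight e\<close>. Integrating over the
  frequency before anything else replaces the two-sided kernel by a real factor.\<close>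

lemma integral_gauss_weight_qft:
  assumes h: "integrable lborel h" and e: "0 < e"
  shows "(LINT \<omega>|lborel. gauss_weight e \<omega> * (norm (qft h \<omega>))\<^sup>2) =
    (LINT v|lborel. gauss_kernel e v * (LINT x|lborel. inner (h x) (h (x + v))))"
proof -
  have [measurable]: "h \<in> borel_measurable borel" using h by auto
  let ?P = "lborel \<Otimes>\<^sub>M lborel :: ((real^2) \<times> (real^2)) measure"
  let ?H = "\<lambda>p. norm (h (fst p)) * norm (h (snd p + fst p))"
  have "sigma_finite_measure ?P"
    unfolding lborel_prod by (rule sigma_finite_lborel)
  then interpret PL: pair_sigma_finite ?P "lborel :: (real^2) measure"
    by (intro pair_sigma_finite.intro sigma_finite_lborel)
  have H: "integrable ?P ?H"
    using integrable_autocorrelation[OF h] by (simp add: case_prod_unfold)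
  let ?F = "\<lambda>p \<omega>. gauss_weight e \<omega> * inner (h (fst p)) (qker \<omega> (snd p) (h (snd p + fst p)))"
  have b: "\<bar>inner (h (fst p)) (qker \<omega> (snd p) (h (snd p + fst p)))\<bar> \<le> ?H p" for p \<omega>
    using Cauchy_Schwarz_ineq2[of "h (fst p)" "qker \<omega> (snd p) (h (snd p + fst p))"] by simp
  have int: "integrable (?P \<Otimes>\<^sub>M lborel) (case_prod ?F)"
  proof (rule Bochner_Integration.integrable_bound)
    show "integrable (?P \<Otimes>\<^sub>M lborel) (\<lambda>(p, \<omega>). ?H p * gauss_weight e \<omega>)"
    proof (rule PL.Fubini_integrable)
      show "integrable ?P (\<lambda>p. LINT \<omega>|lborel. norm (case (p, \<omega>) of (p, \<omega>) \<Rightarrow> ?H p * gauss_weight e \<omega>))"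
        using H by (simp add: abs_mult)
    qed (use integrable_gauss_weight[OF e] in simp_all)
    show "AE z in ?P \<Otimes>\<^sub>M lborel. norm (case_prod ?F z) \<le> norm (case z of (p, \<omega>) \<Rightarrow> ?H p * gauss_weight e \<omega>)"
      by (rule AE_I2) (auto simp: abs_mult mult.commute[of "gauss_weight _ _"] intro!: mult_right_mono b[of "(_, _)", simplified])
  qed measurable
  have F: "(LINT \<omega>|lborel. ?F p \<omega>) = gauss_kernel e (snd p) * inner (h (fst p)) (h (snd p + fst p))" for p
  proof -
    note g = has_bochner_integral_gauss_qker[OF e, of "snd p" "h (snd p + fst p)"]
    have "(LINT \<omega>|lborel. ?F p \<omega>)
        = (LINT \<omega>|lborel. inner (h (fst p)) (gauss_weight e \<omega> *\<^sub>R qker \<omega> (snd p) (h (snd p + fst p))))"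
      by simp
    also have "\<dots> = inner (h (fst p)) (gauss_kernel e (snd p) *\<^sub>R h (snd p + fst p))"
      using has_bochner_integral_inner_right[OF g, of "h (fst p)"] by (simp only: has_bochner_integral_iff)
    finally show ?thesis by simp
  qed
  have "(LINT \<omega>|lborel. gauss_weight e \<omega> * (norm (qft h \<omega>))\<^sup>2) = (LINT \<omega>|lborel. LINT p|?P. ?F p \<omega>)"
    unfolding norm_qft_square[OF h] by simp
  also have "\<dots> = (LINT p|?P. LINT \<omega>|lborel. ?F p \<omega>)"
    by (rule PL.Fubini_integral[OF int])
  also have "\<dots> = (LINT p|?P. gauss_kernel e (snd p) * inner (h (fst p)) (h (snd p + fst p)))"
    by (simp only: F)
  also have "\<dots> = (LINT v|lborel. LINT x|lborel. gauss_kernel e v * inner (h x) (h (v + x)))"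
  proof (subst lborel_pair.integral_snd)
    show "integrable ?P (\<lambda>(x, v). gauss_kernel e v * inner (h x) (h (v + x)))"
      using PL.integrable_fst[OF int] by (simp add: F case_prod_unfold)
  qed (simp add: case_prod_unfold)
  finally show ?thesis by (simp add: add.commute)
qed

theorem qft_plancherel:
  assumes h: "integrable lborel h" and h2: "integrable lborel (\<lambda>x. (norm (h x))\<^sup>2)"
  shows "has_bochner_integral lborel (\<lambda>\<omega>. (norm (qft h \<omega>))\<^sup>2) (LINT x|lborel. (norm (h x))\<^sup>2)"
proof -
  have [measurable]: "h \<in> borel_measurable borel" using h by auto
  let ?H = "LINT x|lborel. (norm (h x))\<^sup>2"
  define D where "D v = (LINT x|lborel. (norm (h x - h (x + v)))\<^sup>2)" for v
  \<comment> \<open>Decreasing, so that the weights increase to 1 and monotone convergence yields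
    the integrability of the squared transform together with its integral.\<close>
  define e :: "nat \<Rightarrow> real" where "e n = 1 / (real n + 1)" for n
  have e: "0 < e n" for n by (simp add: e_def)
  have e0: "e \<longlonglongrightarrow> 0"
    unfolding e_def using LIMSEQ_inverse_real_of_nat by (simp add: inverse_eq_divide add.commute)
  have emono: "e n \<le> e m" if "m \<le> n" for m n
    using that by (simp add: e_def frac_le)
  have s: "integrable lborel (\<lambda>x. (norm (h (x + v)))\<^sup>2)" "(LINT x|lborel. (norm (h (x + v)))\<^sup>2) = ?H" for v
    using integrable_lborel_shift[of "\<lambda>x. (norm (h x))\<^sup>2" v] h2
      integral_lborel_shift[of "\<lambda>x. (norm (h x))\<^sup>2" v] by auto
  have d: "integrable lborel (\<lambda>x. (norm (h x - h (x + v)))\<^sup>2)" for v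
    by (rule integrable_norm_diff_square[OF _ _ h2 s(1)]) auto
  have [measurable]: "D \<in> borel_measurable borel"
    unfolding D_def by measurable
  have D0: "0 \<le> D v" for v by (simp add: D_def)
  have D4: "D v \<le> 4 * ?H" for v
  proof -
    have "D v \<le> (LINT x|lborel. 2 * (norm (h x))\<^sup>2 + 2 * (norm (h (x + v)))\<^sup>2)"
      unfolding D_def using h2 s d by (intro integral_mono norm_diff_square_le) auto
    also have "\<dots> = 4 * ?H" using h2 s by simp
    finally show ?thesis .
  qed
  \<comment> \<open>Polarization: the autocorrelation falls short of its value at
    \<open>v = 0\<close> by half the mean-square displacement \<open>D v\<close>, which is small
    near 0 by continuity of translations.\<close>
  have A: "(LINT x|lborel. inner (h x) (h (x + v))) = ?H - D v / 2" for v
  proof -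
    have "inner (h x) (h (x + v)) = ((norm (h x))\<^sup>2 + (norm (h (x + v)))\<^sup>2 - (norm (h x - h (x + v)))\<^sup>2) / 2" for x
      by (simp add: power2_norm_eq_inner algebra_simps inner_commute)
    then show ?thesis
      unfolding D_def using h2 s d by (simp add: diff_divide_distrib add_divide_distrib)
  qed
  have kD: "integrable lborel (\<lambda>v. gauss_kernel (e n) v * D v)" for n
  proof (rule Bochner_Integration.integrable_bound)
    show "integrable lborel (\<lambda>v. gauss_kernel (e n) v * (4 * ?H))"
      using has_bochner_integral_gauss_kernel[OF e] by (simp add: has_bochner_integral_iff)
    show "AE v in lborel. norm (gauss_kernel (e n) v * D v) \<le> norm (gauss_kernel (e n) v * (4 * ?H))"
      using D0 D4 by (auto intro!: AE_I2 mult_left_mono simp: abs_mult)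
  qed measurable
  have val: "(LINT \<omega>|lborel. gauss_weight (e n) \<omega> * (norm (qft h \<omega>))\<^sup>2)
      = ?H - (LINT v|lborel. gauss_kernel (e n) v * D v) / 2" for n
  proof -
    have "(LINT \<omega>|lborel. gauss_weight (e n) \<omega> * (norm (qft h \<omega>))\<^sup>2)
      = (LINT v|lborel. gauss_kernel (e n) v * ?H - (gauss_kernel (e n) v * D v) / 2)"
      unfolding integral_gauss_weight_qft[OF h e] A by (simp add: right_diff_distrib)
    also have "\<dots> = 1 * ?H - (LINT v|lborel. gauss_kernel (e n) v * D v) / 2"
      using has_bochner_integral_gauss_kernel[OF e, of n] kD[of n]
      by (simp add: has_bochner_integral_iff)
    finally show ?thesis by simp
  qed
  have "(\<lambda>n. LINT v|lborel. gauss_kernel (e n) v * D v) \<longlonglongrightarrow> 0"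
    by (rule gauss_kernel_approx_identity[OF _ D0 D4 _ _ e e0])
       (use translation_continuous_L2[OF _ h2] in \<open>simp_all add: D_def\<close>)
  then have lim: "(\<lambda>n. LINT \<omega>|lborel. gauss_weight (e n) \<omega> * (norm (qft h \<omega>))\<^sup>2) \<longlonglongrightarrow> ?H"
    unfolding val using tendsto_diff[OF tendsto_const tendsto_divide[OF _ tendsto_const]] by fastforce
  show ?thesis
  proof (rule has_bochner_integral_monotone_convergence[where f="\<lambda>n \<omega>. gauss_weight (e n) \<omega> * (norm (qft h \<omega>))\<^sup>2"])
    show "integrable lborel (\<lambda>\<omega>. gauss_weight (e n) \<omega> * (norm (qft h \<omega>))\<^sup>2)" for n
    proof (rule Bochner_Integration.integrable_bound)
      show "integrable lborel (\<lambda>\<omega>. gauss_weight (e n) \<omega> * (LINT x|lborel. norm (h x))\<^sup>2)"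
        using integrable_gauss_weight[OF e] by simp
      show "AE \<omega> in lborel. norm (gauss_weight (e n) \<omega> * (norm (qft h \<omega>))\<^sup>2)
          \<le> norm (gauss_weight (e n) \<omega> * (LINT x|lborel. norm (h x))\<^sup>2)"
        using norm_qft_le[OF h] by (auto intro!: AE_I2 mult_left_mono power_mono simp: abs_mult)
    qed measurable
    have "gauss_weight (e m) \<omega> \<le> gauss_weight (e n) \<omega>" if "m \<le> n" for m n \<omega>
    proof -
      have "(e n * c)\<^sup>2 \<le> (e m * c)\<^sup>2" for c :: real
        unfolding power_mult_distrib using emono[OF that] e[of n] by (intro mult_right_mono power_mono) auto
      then show ?thesis unfolding gauss_weight_def by (intro mult_mono) auto
    qed
    then show "AE \<omega> in lborel. mono (\<lambda>n. gauss_weight (e n) \<omega> * (norm (qft h \<omega>))\<^sup>2)"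
      by (auto intro!: AE_I2 monoI mult_right_mono)
    have "(\<lambda>n. gauss_weight (e n) \<omega>) \<longlonglongrightarrow> exp (- (0 * \<omega> $ 1)\<^sup>2 / 2) * exp (- (0 * \<omega> $ 2)\<^sup>2 / 2)" for \<omega>
      unfolding gauss_weight_def by (intro tendsto_intros e0) auto
    then have "(\<lambda>n. gauss_weight (e n) \<omega> * (norm (qft h \<omega>))\<^sup>2) \<longlonglongrightarrow> 1 * (norm (qft h \<omega>))\<^sup>2" for \<omega>
      by (intro tendsto_mult tendsto_const) simp
    then show "AE \<omega> in lborel. (\<lambda>n. gauss_weight (e n) \<omega> * (norm (qft h \<omega>))\<^sup>2) \<longlonglongrightarrow> (norm (qft h \<omega>))\<^sup>2"
      by simp
  qed (use lim in auto)
qed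

section \<open>Inversion of the quaternionic Fourier transform\<close>

lemma (in pair_sigma_finite) integrable_mult_pair:
  fixes f g :: "_ \<Rightarrow> real"
  assumes f: "integrable M1 f" and g: "integrable M2 g"
  shows "integrable (M1 \<Otimes>\<^sub>M M2) (\<lambda>(x, y). f x * g y)"
proof (rule Fubini_integrable)
  have [measurable]: "f \<in> borel_measurable M1" "g \<in> borel_measurable M2" using f g by auto
  show "(\<lambda>(x, y). f x * g y) \<in> borel_measurable (M1 \<Otimes>\<^sub>M M2)" by measurable
  show "integrable M1 (\<lambda>x. \<integral>y. norm (case (x, y) of (x, y) \<Rightarrow> f x * g y) \<partial>M2)"
    using f by (simp add: abs_mult)
qed (use g in simp)

lemma integrable_indicator_scaleR_bounded:
  fixes F :: "'a \<Rightarrow> 'b::{banach,second_countable_topology}"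
  assumes [measurable]: "F \<in> borel_measurable M" "K \<in> sets M" and K: "emeasure M K < \<infinity>"
    and B: "\<And>x. norm (F x) \<le> B"
  shows "integrable M (\<lambda>x. indicator K x *\<^sub>R F x)"
proof (rule Bochner_Integration.integrable_bound)
  show "integrable M (\<lambda>x. indicator K x *\<^sub>R B)"
    using K by simp
  show "AE x in M. norm (indicator K x *\<^sub>R F x) \<le> norm (indicator K x *\<^sub>R B)"
    using B by (auto intro!: AE_I2 order_trans[OF B] split: split_indicator)
qed measurable

text \<open>The inverse transform is the adjoint of \<open>qft\<close>: Fubini combined with the
  adjoint relation of the kernel at each pair of points.\<close>

lemma qft_parseval:
  assumes G: "integrable lborel G" and h: "integrable lborel h"
  shows "(LINT x|lborel. inner (qft G (- x)) (h x)) = (LINT \<omega>|lborel. inner (G \<omega>) (qft h \<omega>))"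
proof -
  have [measurable]: "h \<in> borel_measurable borel" "G \<in> borel_measurable borel" using G h by auto
  let ?F = "\<lambda>x \<omega>. inner (G \<omega>) (qker \<omega> x (h x))"
  have int: "integrable (lborel \<Otimes>\<^sub>M lborel) (\<lambda>(x, \<omega>). ?F x \<omega>)"
  proof (rule Bochner_Integration.integrable_bound)
    show "integrable (lborel \<Otimes>\<^sub>M lborel) (\<lambda>(x, \<omega>). norm (h x) * norm (G \<omega>))"
      using G h by (intro lborel_pair.integrable_mult_pair) auto
    show "AE z in lborel \<Otimes>\<^sub>M lborel. norm (case z of (x, \<omega>) \<Rightarrow> ?F x \<omega>)
        \<le> norm (case z of (x, \<omega>) \<Rightarrow> norm (h x) * norm (G \<omega>))"
      using Cauchy_Schwarz_ineq2[of "G \<omega>" "qker \<omega> x (h x)" for \<omega> x]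
      by (auto intro!: AE_I2 simp: mult.commute)
  qed measurable
  have "(LINT x|lborel. inner (qft G (- x)) (h x)) = (LINT x|lborel. LINT \<omega>|lborel. ?F x \<omega>)"
  proof (rule Bochner_Integration.integral_cong[OF refl])
    fix x
    have "inner (qft G (- x)) (h x) = (LINT \<omega>|lborel. inner (qker (- x) \<omega> (G \<omega>)) (h x))"
      unfolding qft_def using integrable_qker[OF G, of "- x"] by simp
    also have "\<dots> = (LINT \<omega>|lborel. ?F x \<omega>)"
      by (simp add: qker_commute[of "- x"] inner_qker_left)
    finally show "inner (qft G (- x)) (h x) = (LINT \<omega>|lborel. ?F x \<omega>)" .
  qed
  also have "\<dots> = (LINT \<omega>|lborel. LINT x|lborel. ?F x \<omega>)"
    by (rule lborel_pair.Fubini_integral[OF int, symmetric])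
  also have "\<dots> = (LINT \<omega>|lborel. inner (G \<omega>) (qft h \<omega>))"
    unfolding qft_def using integrable_qker[OF h] by simp
  finally show ?thesis .
qed

text \<open>A Pythagorean identity. In the expansion of the squared distance from \<open>u\<close>
  to \<open>h\<close>, Plancherel for \<open>G\<close> turns the energy of \<open>u\<close> into
  that of \<open>G\<close>, Parseval turns the cross term into the same energy, and Plancherel for
  \<open>h\<close> gives the full energy of the transform; what remains is the part outside
  \<open>K\<close>.\<close>

lemma qft_truncated_inversion:
  assumes h: "integrable lborel h" and h2: "integrable lborel (\<lambda>x. (norm (h x))\<^sup>2)"
    and K[measurable]: "K \<in> sets borel" and Kfin: "emeasure lborel K < \<infinity>"
  shows "has_bochner_integral lborel
    (\<lambda>x. (norm (qft (\<lambda>\<omega>. indicator K \<omega> *\<^sub>R qft h \<omega>) (- x) - h x))\<^sup>2)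
    (LINT \<omega>|lborel. indicator (- K) \<omega> * (norm (qft h \<omega>))\<^sup>2)"
proof -
  have [measurable]: "h \<in> borel_measurable borel" using h by auto
  define G where "G \<omega> = indicator K \<omega> *\<^sub>R qft h \<omega>" for \<omega>
  have [measurable]: "G \<in> borel_measurable borel" unfolding G_def by measurable
  define u where "u x = qft G (- x)" for x
  have [measurable]: "u \<in> borel_measurable borel" unfolding u_def by measurable
  \<comment> \<open>A bounded function restricted to a set of finite measure: this makes
    \<open>u\<close> a convergent integral at every point.\<close>
  have G: "integrable lborel G"
    unfolding G_def using Kfin norm_qft_le[OF h] by (intro integrable_indicator_scaleR_bounded) auto
  note P = qft_plancherel[OF h h2, unfolded has_bochner_integral_iff]
  have nG: "(norm (G \<omega>))\<^sup>2 = indicator K \<omega> * (norm (qft h \<omega>))\<^sup>2" for \<omega>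
    by (simp add: G_def split: split_indicator)
  have iK: "integrable lborel (\<lambda>\<omega>. indicator A \<omega> * (norm (qft h \<omega>))\<^sup>2)" if "A \<in> sets borel" for A
    using integrable_mult_indicator[of A lborel "\<lambda>\<omega>. (norm (qft h \<omega>))\<^sup>2"] P that by simp
  have G2: "integrable lborel (\<lambda>\<omega>. (norm (G \<omega>))\<^sup>2)"
    unfolding nG by (rule iK) simp
  note PG = qft_plancherel[OF G G2, unfolded has_bochner_integral_iff]
  have u2: "integrable lborel (\<lambda>x. (norm (u x))\<^sup>2)"
    "(LINT x|lborel. (norm (u x))\<^sup>2) = (LINT \<omega>|lborel. (norm (G \<omega>))\<^sup>2)"
    using integrable_lborel_reflect[of "\<lambda>x. (norm (qft G x))\<^sup>2" 0]
      integral_lborel_reflect[of "\<lambda>x. (norm (qft G x))\<^sup>2" 0] PG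
    unfolding u_def by auto
  have i: "integrable lborel (\<lambda>x. inner (u x) (h x))"
  proof (rule Bochner_Integration.integrable_bound)
    show "integrable lborel (\<lambda>x. (LINT \<omega>|lborel. norm (G \<omega>)) * norm (h x))"
      using h by simp
    show "AE x in lborel. norm (inner (u x) (h x)) \<le> norm ((LINT \<omega>|lborel. norm (G \<omega>)) * norm (h x))"
    proof (rule AE_I2)
      fix x
      have "\<bar>inner (u x) (h x)\<bar> \<le> norm (u x) * norm (h x)" by (rule Cauchy_Schwarz_ineq2)
      also have "\<dots> \<le> (LINT \<omega>|lborel. norm (G \<omega>)) * norm (h x)"
        unfolding u_def by (intro mult_right_mono norm_qft_le[OF G]) auto
      finally show "norm (inner (u x) (h x)) \<le> norm ((LINT \<omega>|lborel. norm (G \<omega>)) * norm (h x))" by simp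
    qed
  qed measurable
  have "(LINT x|lborel. inner (u x) (h x)) = (LINT \<omega>|lborel. inner (G \<omega>) (qft h \<omega>))"
    unfolding u_def by (rule qft_parseval[OF G h])
  also have "\<dots> = (LINT \<omega>|lborel. (norm (G \<omega>))\<^sup>2)"
    by (simp add: nG) (simp add: G_def power2_norm_eq_inner)
  finally have c: "(LINT x|lborel. inner (u x) (h x)) = (LINT \<omega>|lborel. (norm (G \<omega>))\<^sup>2)" .
  have eq: "(norm (u x - h x))\<^sup>2 = (norm (u x))\<^sup>2 - 2 * inner (u x) (h x) + (norm (h x))\<^sup>2" for x
    by (simp add: power2_norm_eq_inner algebra_simps inner_commute)
  have "has_bochner_integral lborel (\<lambda>x. (norm (u x - h x))\<^sup>2)
      ((LINT \<omega>|lborel. (norm (qft h \<omega>))\<^sup>2) - (LINT \<omega>|lborel. (norm (G \<omega>))\<^sup>2))"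
    unfolding eq has_bochner_integral_iff using u2 i h2 c P by simp
  also have "(LINT \<omega>|lborel. (norm (qft h \<omega>))\<^sup>2) - (LINT \<omega>|lborel. (norm (G \<omega>))\<^sup>2)
      = (LINT \<omega>|lborel. (norm (qft h \<omega>))\<^sup>2 - (norm (G \<omega>))\<^sup>2)"
    using P G2 by simp
  also have "\<dots> = (LINT \<omega>|lborel. indicator (- K) \<omega> * (norm (qft h \<omega>))\<^sup>2)"
    by (intro Bochner_Integration.integral_cong) (auto simp: nG split: split_indicator)
  finally show ?thesis unfolding u_def G_def .
qed

text \<open>The truncated inverses over growing balls have two limits. They converge to
  \<open>h\<close> in mean square, hence almost everywhere along a subsequence, and to the full
  inverse at every point by dominated convergence.\<close>

lemma qft_inversion_AE:
  assumes h: "integrable lborel h" and h2: "integrable lborel (\<lambda>x. (norm (h x))\<^sup>2)"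
    and G: "integrable lborel (qft h)"
  shows "AE x in lborel. qft (qft h) (- x) = h x"
proof -
  have [measurable]: "h \<in> borel_measurable borel" using h by auto
  define K :: "nat \<Rightarrow> (real^2) set" where "K n = cball 0 (real n)" for n
  have K[measurable]: "K n \<in> sets borel" for n by (simp add: K_def)
  have ev: "\<forall>\<^sub>F n in sequentially. x \<in> K n" for x
  proof -
    obtain N where "norm x \<le> real N" using real_arch_simple by blast
    then show ?thesis unfolding K_def by (intro eventually_sequentiallyI[of N]) auto
  qed
  let ?u = "\<lambda>n x. qft (\<lambda>\<omega>. indicator (K n) \<omega> *\<^sub>R qft h \<omega>) (- x)"
  have "emeasure lborel (K n) < \<infinity>" for n
    unfolding K_def by (rule emeasure_lborel_cball_finite)
  note T = qft_truncated_inversion[OF h h2 K this, unfolded has_bochner_integral_iff]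
  have "(\<lambda>n. LINT \<omega>|lborel. indicator (- K n) \<omega> * (norm (qft h \<omega>))\<^sup>2) \<longlonglongrightarrow> (LINT \<omega>|(lborel :: (real^2) measure). 0)"
  proof (rule integral_dominated_convergence)
    show "integrable lborel (\<lambda>\<omega>. (norm (qft h \<omega>))\<^sup>2)"
      using qft_plancherel[OF h h2] by (simp add: has_bochner_integral_iff)
    show "AE \<omega> in lborel. (\<lambda>n. indicator (- K n) \<omega> * (norm (qft h \<omega>))\<^sup>2) \<longlonglongrightarrow> 0"
    proof (rule AE_I2, rule tendsto_eventually)
      fix \<omega>
      show "\<forall>\<^sub>F n in sequentially. indicator (- K n) \<omega> * (norm (qft h \<omega>))\<^sup>2 = 0"
        using ev[of \<omega>] by eventually_elim simp
    qed
  qed (auto split: split_indicator)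
  then have L1: "(\<lambda>n. LINT x|lborel. norm ((norm (?u n x - h x))\<^sup>2)) \<longlonglongrightarrow> 0"
    using T by simp
  obtain r :: "nat \<Rightarrow> nat" where r: "strict_mono r"
    and AE: "AE x in lborel. (\<lambda>n. (norm (?u (r n) x - h x))\<^sup>2) \<longlonglongrightarrow> 0"
    using tendsto_L1_AE_subseq[OF _ L1] T by auto
  have lim: "(\<lambda>n. ?u n x) \<longlonglongrightarrow> qft (qft h) (- x)" for x
    unfolding qft_def[of _ "- x"]
  proof (rule integral_dominated_convergence)
    show "integrable lborel (\<lambda>\<omega>. norm (qft h \<omega>))" using G by simp
    show "AE \<omega> in lborel. (\<lambda>n. qker (- x) \<omega> (indicator (K n) \<omega> *\<^sub>R qft h \<omega>)) \<longlonglongrightarrow> qker (- x) \<omega> (qft h \<omega>)"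
    proof (rule AE_I2, rule tendsto_eventually)
      fix \<omega>
      show "\<forall>\<^sub>F n in sequentially. qker (- x) \<omega> (indicator (K n) \<omega> *\<^sub>R qft h \<omega>) = qker (- x) \<omega> (qft h \<omega>)"
        using ev[of \<omega>] by eventually_elim simp
    qed
  qed (auto split: split_indicator)
  show ?thesis
    using AE
  proof eventually_elim
    case (elim x)
    have "(\<lambda>n. ?u (r n) x) \<longlonglongrightarrow> qft (qft h) (- x)"
      using LIMSEQ_subseq_LIMSEQ[OF lim r] by (simp add: comp_def)
    then have "(\<lambda>n. (norm (?u (r n) x - h x))\<^sup>2) \<longlonglongrightarrow> (norm (qft (qft h) (- x) - h x))\<^sup>2"
      by (intro tendsto_intros)
    from LIMSEQ_unique[OF this elim] show ?case by simp
  qed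
qed

section \<open>Reconstruction for Borel signals and windows\<close>

text \<open>Because the norm is multiplicative, the inequality for products in the algebra reduces
  to Cauchy-Schwarz for nonnegative functions.\<close>

lemma
  fixes a b :: "'a \<Rightarrow> 'b::{real_normed_div_algebra,banach,second_countable_topology}"
  assumes [measurable]: "a \<in> borel_measurable M" "b \<in> borel_measurable M"
    and a: "integrable M (\<lambda>x. (norm (a x))\<^sup>2)" and b: "integrable M (\<lambda>x. (norm (b x))\<^sup>2)"
  shows integrable_mult_square_integrable: "integrable M (\<lambda>x. a x * b x)"
    and norm_integral_mult_square_le:
      "(norm (LINT x|M. a x * b x))\<^sup>2 \<le> (LINT x|M. (norm (a x))\<^sup>2) * (LINT x|M. (norm (b x))\<^sup>2)"
proof -
  show int: "integrable M (\<lambda>x. a x * b x)"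
  proof (rule Bochner_Integration.integrable_bound)
    show "integrable M (\<lambda>x. (norm (a x))\<^sup>2 + (norm (b x))\<^sup>2)" using a b by simp
    show "AE x in M. norm (a x * b x) \<le> norm ((norm (a x))\<^sup>2 + (norm (b x))\<^sup>2)"
    proof (rule AE_I2)
      fix x
      have "2 * (norm (a x) * norm (b x)) \<le> (norm (a x))\<^sup>2 + (norm (b x))\<^sup>2"
        using sum_squares_bound[of "norm (a x)" "norm (b x)"] by simp
      moreover have "0 \<le> norm (a x) * norm (b x)" by simp
      ultimately show "norm (a x * b x) \<le> norm ((norm (a x))\<^sup>2 + (norm (b x))\<^sup>2)"
        unfolding norm_mult real_norm_def by linarith
    qed
  qed measurable
  have "ennreal ((norm (LINT x|M. a x * b x))\<^sup>2) = (ennreal (norm (LINT x|M. a x * b x)))\<^sup>2"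
    by (simp add: ennreal_power)
  also have "\<dots> \<le> (\<integral>\<^sup>+x. ennreal (norm (a x)) * ennreal (norm (b x)) \<partial>M)\<^sup>2"
    using integral_norm_bound_ennreal[OF int] by (intro power_mono) (auto simp: norm_mult ennreal_mult)
  also have "\<dots> \<le> (\<integral>\<^sup>+x. (ennreal (norm (a x)))\<^sup>2 \<partial>M) * (\<integral>\<^sup>+x. (ennreal (norm (b x)))\<^sup>2 \<partial>M)"
    by (rule Cauchy_Schwarz_nn_integral) auto
  also have "\<dots> = ennreal (LINT x|M. (norm (a x))\<^sup>2) * ennreal (LINT x|M. (norm (b x))\<^sup>2)"
    using a b by (simp add: ennreal_power nn_integral_eq_integral)
  also have "\<dots> = ennreal ((LINT x|M. (norm (a x))\<^sup>2) * (LINT x|M. (norm (b x))\<^sup>2))"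
    by (simp add: ennreal_mult)
  finally show "(norm (LINT x|M. a x * b x))\<^sup>2 \<le> (LINT x|M. (norm (a x))\<^sup>2) * (LINT x|M. (norm (b x))\<^sup>2)"
    by (subst (asm) ennreal_le_iff) auto
qed

lemma norm_qcnj [simp]: "norm (qcnj q) = norm q"
  by (simp add: norm_quat_def)

lemma qcnj_mult: "qcnj q * q = of_real ((norm q)\<^sup>2)"
proof -
  have "qcnj q * q = q * qcnj q" by (simp add: quat_eq_iff)
  then show ?thesis by (simp only: mult_qcnj)
qed

lemma borel_measurable_qcnj [measurable]: "qcnj \<in> borel_measurable borel"
proof -
  have "linear qcnj" by (rule linearI) (simp_all add: quat_eq_iff)
  then show ?thesis
    by (intro borel_measurable_continuous_onI linear_continuous_on) (simp add: linear_conv_bounded_linear)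
qed

text \<open>
  Fubini's theorem needs \<open>\<phi>(x - b)\<close> to be measurable in \<open>(x, b)\<close> for the product of the two Lebesgue
  \<open>\<sigma>\<close>-algebras, which is immediate only for Borel \<open>\<phi>\<close>.
\<close>

locale borel_gabor_pair =
  fixes \<phi> f :: "real ^ 2 \<Rightarrow> quat"
  assumes borel_phi [measurable]: "\<phi> \<in> borel_measurable borel"
    and borel_f [measurable]: "f \<in> borel_measurable borel"
    and phi2: "integrable lborel (\<lambda>x. (norm (\<phi> x))\<^sup>2)"
    and f2: "integrable lborel (\<lambda>x. (norm (f x))\<^sup>2)"
begin

definition N where "N = (LINT x|lborel. (norm (\<phi> x))\<^sup>2)"

definition windowed where "windowed b x = f x * qcnj (\<phi> (x - b))"

definition G where "G b = qft (windowed b)"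

text \<open>The inverse transform from the frequencies in \<open>K\<close>, with \<open>- x\<close>
  reversing the signs of both exponents. For \<open>K\<close> of finite measure it converges
  absolutely for every \<open>b\<close>, even where \<open>windowed b\<close> is not
  square-integrable.\<close>

definition truncated where "truncated K b x = qft (\<lambda>\<omega>. indicator K \<omega> *\<^sub>R G b \<omega>) (- x)"

lemma borel_windowed [measurable]:
  assumes [measurable]: "b \<in> borel_measurable M" "x \<in> borel_measurable M"
  shows "(\<lambda>z. windowed (b z) (x z)) \<in> borel_measurable M"
  unfolding windowed_def by measurable

lemma borel_G [measurable]:
  assumes [measurable]: "b \<in> borel_measurable M" "x \<in> borel_measurable M"
  shows "(\<lambda>z. G (b z) (x z)) \<in> borel_measurable M"
  unfolding G_def qft_def by measurable

lemma borel_truncated [measurable]: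
  assumes [measurable]: "b \<in> borel_measurable M" "x \<in> borel_measurable M" "K \<in> sets borel"
  shows "(\<lambda>z. truncated K (b z) (x z)) \<in> borel_measurable M"
  unfolding truncated_def qft_def[of "\<lambda>\<omega>. indicator K \<omega> *\<^sub>R G _ \<omega>"] by measurable

lemma N_nonneg: "0 \<le> N"
  by (simp add: N_def)

lemma phi_window:
  "integrable lborel (\<lambda>b. (norm (\<phi> (x - b)))\<^sup>2)" "(LINT b|lborel. (norm (\<phi> (x - b)))\<^sup>2) = N"
  "integrable lborel (\<lambda>y. (norm (\<phi> (y - b)))\<^sup>2)"
  using integrable_lborel_reflect[of "\<lambda>x. (norm (\<phi> x))\<^sup>2" x] integral_lborel_reflect[of "\<lambda>x. (norm (\<phi> x))\<^sup>2" x]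
    integrable_lborel_shift[of "\<lambda>x. (norm (\<phi> x))\<^sup>2" "- b"] phi2
  by (simp_all add: N_def)

lemma norm_windowed: "norm (windowed b x) = norm (f x) * norm (\<phi> (x - b))"
  by (simp add: windowed_def norm_mult)

lemma windowed_mult_phi: "windowed b x * \<phi> (x - b) = (norm (\<phi> (x - b)))\<^sup>2 *\<^sub>R f x"
  by (simp add: windowed_def mult.assoc qcnj_mult) (simp add: of_real_def)

lemma windowed_integrable: "integrable lborel (windowed b)"
  unfolding windowed_def
  by (rule integrable_mult_square_integrable) (use f2 phi_window(3) in simp_all)

text \<open>For fixed \<open>x\<close> the integral over \<open>b\<close> is \<open>N\<close> times
  the squared norm of \<open>f x\<close>, so the total energy is finite. For fixed \<open>b\<close>
  Fubini gives finiteness only almost everywhere, hence the exceptional null set of shifts in what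
  follows.\<close>

lemma windowed_square_integrable_pair: "integrable (lborel \<Otimes>\<^sub>M lborel) (\<lambda>(x, b). (norm (windowed b x))\<^sup>2)"
proof (rule lborel_pair.Fubini_integrable)
  show "integrable lborel (\<lambda>x. LINT b|lborel. norm (case (x, b) of (x, b) \<Rightarrow> (norm (windowed b x))\<^sup>2))"
    using f2 by (simp add: norm_windowed power_mult_distrib phi_window)
  show "AE x in lborel. integrable lborel (\<lambda>b. case (x, b) of (x, b) \<Rightarrow> (norm (windowed b x))\<^sup>2)"
    by (simp add: norm_windowed power_mult_distrib phi_window)
qed measurable

lemma windowed_square_integrable_AE: "AE b in lborel. integrable lborel (\<lambda>x. (norm (windowed b x))\<^sup>2)"
  by (rule lborel_pair.AE_integrable_snd[OF windowed_square_integrable_pair])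

section \<open>Energy of the windowed transforms outside a frequency set\<close>

lemma G_plancherel_AE:
  "AE b in lborel. has_bochner_integral lborel (\<lambda>\<omega>. (norm (G b \<omega>))\<^sup>2) (LINT x|lborel. (norm (windowed b x))\<^sup>2)"
  using windowed_square_integrable_AE unfolding G_def
  by eventually_elim (rule qft_plancherel[OF windowed_integrable])

definition tail where "tail K b = (LINT \<omega>|lborel. indicator (- K) \<omega> * (norm (G b \<omega>))\<^sup>2)"

lemma borel_tail [measurable]:
  assumes [measurable]: "K \<in> sets borel"
  shows "tail K \<in> borel_measurable borel"
  unfolding tail_def by measurable

lemma tail_bounds_AE:
  assumes [measurable]: "K \<in> sets borel"
  shows "AE b in lborel. norm (tail K b) \<le> (LINT x|lborel. (norm (windowed b x))\<^sup>2)"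
  using G_plancherel_AE
proof eventually_elim
  case (elim b)
  then have "integrable lborel (\<lambda>\<omega>. (norm (G b \<omega>))\<^sup>2)" "(LINT \<omega>|lborel. (norm (G b \<omega>))\<^sup>2) = (LINT x|lborel. (norm (windowed b x))\<^sup>2)"
    by (simp_all add: has_bochner_integral_iff)
  moreover have "tail K b \<le> (LINT \<omega>|lborel. (norm (G b \<omega>))\<^sup>2)"
    unfolding tail_def by (rule integral_mono') (use calculation in \<open>auto split: split_indicator\<close>)
  moreover have "0 \<le> tail K b"
    by (simp add: tail_def)
  ultimately show ?case by simp
qed

lemma windowed_square_integrable: "integrable lborel (\<lambda>b. LINT x|lborel. (norm (windowed b x))\<^sup>2)"
  by (rule lborel_pair.integrable_snd[OF windowed_square_integrable_pair])

lemma tail_integrable: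
  assumes [measurable]: "K \<in> sets borel"
  shows "integrable lborel (tail K)"
  by (rule Bochner_Integration.integrable_bound[OF windowed_square_integrable])
     (use tail_bounds_AE[OF assms] in \<open>auto elim: AE_mp\<close>)

text \<open>Dominated convergence at two levels: in \<open>\<omega>\<close> for almost every
  \<open>b\<close>, with the squared norm of \<open>G b \<omega>\<close> as majorant, then in
  \<open>b\<close>, with the energy of \<open>windowed b\<close> as majorant.\<close>

lemma tail_tendsto:
  assumes K[measurable]: "\<And>n. K n \<in> sets borel"
    and lim: "AE \<omega> in lborel. \<forall>\<^sub>F n in sequentially. \<omega> \<in> K n"
  shows "(\<lambda>n. LINT b|lborel. tail (K n) b) \<longlonglongrightarrow> 0"
proof -
  have "(\<lambda>n. LINT b|lborel. tail (K n) b) \<longlonglongrightarrow> (LINT b|(lborel :: (real^2) measure). 0)"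
  proof (rule integral_dominated_convergence[OF _ _ windowed_square_integrable])
    show "AE b in lborel. (\<lambda>n. tail (K n) b) \<longlonglongrightarrow> 0"
      using G_plancherel_AE
    proof eventually_elim
      case (elim b)
      have "(\<lambda>n. tail (K n) b) \<longlonglongrightarrow> (LINT \<omega>|(lborel :: (real^2) measure). 0)"
        unfolding tail_def
      proof (rule integral_dominated_convergence)
        show "integrable lborel (\<lambda>\<omega>. (norm (G b \<omega>))\<^sup>2)"
          using elim by (simp add: has_bochner_integral_iff)
        show "AE \<omega> in lborel. (\<lambda>n. indicator (- K n) \<omega> * (norm (G b \<omega>))\<^sup>2) \<longlonglongrightarrow> 0"
          using lim
          by eventually_elim (auto intro!: tendsto_eventually elim!: eventually_mono)
      qed (auto split: split_indicator)
      then show ?case by simp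
    qed
  qed (use tail_bounds_AE[OF K] in auto)
  then show ?thesis by simp
qed

text \<open>The error identity holds for almost every \<open>b\<close> as an integral over
  \<open>x\<close>. Exchanging the integrals prepares an estimate at fixed \<open>x\<close>, where
  Cauchy-Schwarz is applied in \<open>b\<close>.\<close>

lemma
  assumes K[measurable]: "K \<in> sets borel" and Kfin: "emeasure lborel K < \<infinity>"
  shows truncation_error_integrable:
      "integrable (lborel \<Otimes>\<^sub>M lborel) (\<lambda>(b, x). (norm (truncated K b x - windowed b x))\<^sup>2)"
    and truncation_error:
      "(LINT x|lborel. LINT b|lborel. (norm (truncated K b x - windowed b x))\<^sup>2) = (LINT b|lborel. tail K b)"
proof -
  have ae: "AE b in lborel. has_bochner_integral lborel (\<lambda>x. (norm (truncated K b x - windowed b x))\<^sup>2) (tail K b)"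
    using windowed_square_integrable_AE unfolding truncated_def G_def tail_def
    by eventually_elim (rule qft_truncated_inversion[OF windowed_integrable _ K Kfin])
  show int: "integrable (lborel \<Otimes>\<^sub>M lborel) (\<lambda>(b, x). (norm (truncated K b x - windowed b x))\<^sup>2)"
  proof (rule lborel_pair.Fubini_integrable)
    show "integrable lborel (\<lambda>b. LINT x|lborel. norm (case (b, x) of (b, x) \<Rightarrow> (norm (truncated K b x - windowed b x))\<^sup>2))"
    proof (rule integrable_cong_AE_imp[OF tail_integrable[OF K]])
      show "AE b in lborel. tail K b = (LINT x|lborel. norm (case (b, x) of (b, x) \<Rightarrow> (norm (truncated K b x - windowed b x))\<^sup>2))"
        using ae by eventually_elim (simp add: has_bochner_integral_iff)
    qed measurable
    show "AE b in lborel. integrable lborel (\<lambda>x. case (b, x) of (b, x) \<Rightarrow> (norm (truncated K b x - windowed b x))\<^sup>2)"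
      using ae by eventually_elim (simp add: has_bochner_integral_iff)
  qed measurable
  have "(LINT x|lborel. LINT b|lborel. (norm (truncated K b x - windowed b x))\<^sup>2)
      = (LINT b|lborel. LINT x|lborel. (norm (truncated K b x - windowed b x))\<^sup>2)"
    by (rule lborel_pair.Fubini_integral[OF int])
  also have "\<dots> = (LINT b|lborel. tail K b)"
    by (rule integral_cong_AE) (use ae in \<open>auto simp: has_bochner_integral_iff elim: AE_mp\<close>)
  finally show "(LINT x|lborel. LINT b|lborel. (norm (truncated K b x - windowed b x))\<^sup>2) = (LINT b|lborel. tail K b)" .
qed

section \<open>Mean-square error of the truncated reconstruction\<close>

definition reconstruction where "reconstruction K x = (1 / N) *\<^sub>R (LINT b|lborel. truncated K b x * \<phi> (x - b))"

lemma borel_reconstruction [measurable]: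
  assumes [measurable]: "K \<in> sets borel"
  shows "reconstruction K \<in> borel_measurable borel"
  unfolding reconstruction_def by measurable

lemma reconstruction_error_AE:
  assumes K[measurable]: "K \<in> sets borel" and Kfin: "emeasure lborel K < \<infinity>" and N: "0 < N"
  shows "AE x in lborel. (norm (reconstruction K x - f x))\<^sup>2 \<le> (1 / N) * (LINT b|lborel. (norm (truncated K b x - windowed b x))\<^sup>2)"
  using lborel_pair.AE_integrable_snd[OF truncation_error_integrable[OF K Kfin]]
proof eventually_elim
  case (elim x)
  let ?a = "\<lambda>b. truncated K b x - windowed b x"
  have i1: "integrable lborel (\<lambda>b. ?a b * \<phi> (x - b))"
    by (rule integrable_mult_square_integrable) (use elim phi_window in simp_all)
  \<comment> \<open>Without truncation the window integral returns exactly
    \<open>N *\<^sub>R f x\<close>, so the error is the integral of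
    \<open>?a b * \<phi> (x - b)\<close>; the factor \<open>N\<close> from Cauchy-Schwarz then
    cancels one of the two factors \<open>1 / N\<close>.\<close>
  have h': "integrable lborel (\<lambda>b. windowed b x * \<phi> (x - b))" "(LINT b|lborel. windowed b x * \<phi> (x - b)) = N *\<^sub>R f x"
    unfolding windowed_mult_phi using phi_window by simp_all
  have "(LINT b|lborel. truncated K b x * \<phi> (x - b)) = (LINT b|lborel. ?a b * \<phi> (x - b) + windowed b x * \<phi> (x - b))"
    by (simp add: algebra_simps)
  also have "\<dots> = (LINT b|lborel. ?a b * \<phi> (x - b)) + N *\<^sub>R f x"
    unfolding Bochner_Integration.integral_add[OF i1 h'(1)] h'(2) ..
  finally have "reconstruction K x - f x = (1 / N) *\<^sub>R (LINT b|lborel. ?a b * \<phi> (x - b))"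
    using N by (simp add: reconstruction_def scaleR_add_right)
  then have "(norm (reconstruction K x - f x))\<^sup>2 = (1 / N)\<^sup>2 * (norm (LINT b|lborel. ?a b * \<phi> (x - b)))\<^sup>2"
    by (simp add: power_mult_distrib power_divide)
  also have "\<dots> \<le> (1 / N)\<^sup>2 * ((LINT b|lborel. (norm (?a b))\<^sup>2) * (LINT b|lborel. (norm (\<phi> (x - b)))\<^sup>2))"
    by (intro mult_left_mono norm_integral_mult_square_le) (use elim phi_window in simp_all)
  also have "\<dots> = (1 / N) * (LINT b|lborel. (norm (?a b))\<^sup>2)"
    unfolding phi_window(2) using N by (simp add: power2_eq_square)
  finally show ?case .
qed

lemma
  assumes K[measurable]: "K \<in> sets borel" and Kfin: "emeasure lborel K < \<infinity>" and N: "0 < N"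
  shows reconstruction_error_integrable: "integrable lborel (\<lambda>x. (norm (reconstruction K x - f x))\<^sup>2)"
    and reconstruction_error_le: "(LINT x|lborel. (norm (reconstruction K x - f x))\<^sup>2) \<le> (1 / N) * (LINT b|lborel. tail K b)"
proof -
  have i: "integrable lborel (\<lambda>x. (1 / N) * (LINT b|lborel. (norm (truncated K b x - windowed b x))\<^sup>2))"
    by (intro integrable_mult_right lborel_pair.integrable_snd[OF truncation_error_integrable[OF K Kfin]])
  show j: "integrable lborel (\<lambda>x. (norm (reconstruction K x - f x))\<^sup>2)"
  proof (rule Bochner_Integration.integrable_bound[OF i])
    show "AE x in lborel. norm ((norm (reconstruction K x - f x))\<^sup>2)
        \<le> norm ((1 / N) * (LINT b|lborel. (norm (truncated K b x - windowed b x))\<^sup>2))"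
      using reconstruction_error_AE[OF assms] by eventually_elim (use N in simp)
  qed measurable
  have "(LINT x|lborel. (norm (reconstruction K x - f x))\<^sup>2)
      \<le> (LINT x|lborel. (1 / N) * (LINT b|lborel. (norm (truncated K b x - windowed b x))\<^sup>2))"
    by (rule integral_mono_AE[OF j i reconstruction_error_AE[OF assms]])
  then show "(LINT x|lborel. (norm (reconstruction K x - f x))\<^sup>2) \<le> (1 / N) * (LINT b|lborel. tail K b)"
    using truncation_error[OF K Kfin] by simp
qed

lemma reconstruction_tendsto:
  assumes K[measurable]: "\<And>n. K n \<in> sets borel" and Kfin: "\<And>n. emeasure lborel (K n) < \<infinity>" and N: "0 < N"
    and lim: "AE \<omega> in lborel. \<forall>\<^sub>F n in sequentially. \<omega> \<in> K n"
  shows "(\<lambda>n. LINT x|lborel. (norm (reconstruction (K n) x - f x))\<^sup>2) \<longlonglongrightarrow> 0"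
proof (rule tendsto_sandwich[OF _ _ tendsto_const])
  show "(\<lambda>n. (1 / N) * (LINT b|lborel. tail (K n) b)) \<longlonglongrightarrow> 0"
    using tendsto_mult_right[OF tail_tendsto[OF K lim], of "1 / N"] by simp
qed (use reconstruction_error_le[OF K Kfin N] in auto)

lemma inversion_AE:
  assumes N: "0 < N"
  shows "AE x in lborel. (AE b in lborel. integrable lborel (\<lambda>\<omega>. qker \<omega> (- x) (G b \<omega>) * \<phi> (x - b))) \<longrightarrow>
    f x = (1 / N) *\<^sub>R (LINT b|lborel. LINT \<omega>|lborel. qker \<omega> (- x) (G b \<omega>) * \<phi> (x - b))"
proof -
  have "AE b in lborel. AE x in lborel. integrable lborel (G b) \<longrightarrow> qft (G b) (- x) = windowed b x"
    using windowed_square_integrable_AE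
  proof eventually_elim
    case (elim b)
    show ?case
      using qft_inversion_AE[OF windowed_integrable elim] unfolding G_def by (cases "integrable lborel (G b)") (auto simp: G_def)
  qed
  \<comment> \<open>Inversion holds at almost every \<open>x\<close> for fixed \<open>b\<close>,
    whereas the outer integral runs over \<open>b\<close> for fixed \<open>x\<close>. With
    integrability of \<open>G b\<close> kept as a premise the exceptional set is measurable in the
    pair, so the quantifiers can be exchanged.\<close>
  then have "AE x in lborel. AE b in lborel. integrable lborel (G b) \<longrightarrow> qft (G b) (- x) = windowed b x"
  proof (subst lborel_pair.AE_commute)
    have [measurable]: "(\<lambda>p. qft (G (snd p)) (- fst p)) \<in> borel_measurable (lborel \<Otimes>\<^sub>M lborel)"
      unfolding qft_def[of "G _"] by measurable
    show "{p \<in> space (lborel \<Otimes>\<^sub>M lborel). integrable lborel (G (snd p)) \<longrightarrow> qft (G (snd p)) (- fst p) = windowed (snd p) (fst p)}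
        \<in> sets (lborel \<Otimes>\<^sub>M lborel)"
      by measurable
  qed
  then show ?thesis
  proof eventually_elim
    case (elim x)
    show ?case
    proof
      assume "AE b in lborel. integrable lborel (\<lambda>\<omega>. qker \<omega> (- x) (G b \<omega>) * \<phi> (x - b))"
      with elim have "AE b in lborel. (LINT \<omega>|lborel. qker \<omega> (- x) (G b \<omega>) * \<phi> (x - b)) = (norm (\<phi> (x - b)))\<^sup>2 *\<^sub>R f x"
      proof eventually_elim
        case (elim b)
        show ?case
        \<comment> \<open>Where the window vanishes the premise says nothing about
          \<open>G b\<close>, but both sides are 0. Elsewhere the window is a nonzero constant in
          \<open>\<omega>\<close>, so integrability passes to \<open>G b\<close>.\<close>
        proof (cases "\<phi> (x - b) = 0")
          case False
          have "integrable lborel (\<lambda>\<omega>. norm (qker \<omega> (- x) (G b \<omega>) * \<phi> (x - b)))"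
            using elim(2) by (rule integrable_norm)
          then have "integrable lborel (\<lambda>\<omega>. norm (G b \<omega>))"
            using False by (simp add: norm_mult)
          then have i: "integrable lborel (G b)"
            by (subst (asm) integrable_norm_iff) measurable
          then have "qft (G b) (- x) = windowed b x" using elim(1) by simp
          moreover have "integrable lborel (\<lambda>\<omega>. qker \<omega> (- x) (G b \<omega>))"
            using integrable_qker[OF i, of "- x"] by (simp add: qker_commute[of "- x"])
          ultimately have "(LINT \<omega>|lborel. qker \<omega> (- x) (G b \<omega>) * \<phi> (x - b)) = windowed b x * \<phi> (x - b)"
            by (simp add: qft_def qker_commute[of "- x"])
          then show ?thesis by (simp only: windowed_mult_phi)
        qed simp
      qed
      then have "(LINT b|lborel. LINT \<omega>|lborel. qker \<omega> (- x) (G b \<omega>) * \<phi> (x - b))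
          = (LINT b|lborel. (norm (\<phi> (x - b)))\<^sup>2 *\<^sub>R f x)"
        by (intro integral_cong_AE) auto
      also have "\<dots> = N *\<^sub>R f x" using phi_window by simp
      finally show "f x = (1 / N) *\<^sub>R (LINT b|lborel. LINT \<omega>|lborel. qker \<omega> (- x) (G b \<omega>) * \<phi> (x - b))"
        using N by simp
    qed
  qed
qed

end

section \<open>Passage to Lebesgue measurable functions\<close>

text \<open>Each real coordinate agrees almost everywhere with a Borel function, and finitely many
  exceptional null sets can be united.\<close>

lemma lebesgue_measurable_borel_representative:
  fixes g :: "'a::euclidean_space \<Rightarrow> 'b::euclidean_space"
  assumes g: "g \<in> borel_measurable lebesgue"
  obtains g' where "g' \<in> borel_measurable borel" "AE x in lborel. g x = g' x"
proof -
  have "\<exists>k\<in>borel_measurable lborel. AE x in lborel. inner (g x) i = k x" for i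
    using g by (intro completion_ex_borel_measurable_real) simp
  then obtain k where k: "\<And>i. k i \<in> borel_measurable lborel" "\<And>i. AE x in lborel. inner (g x) i = k i x"
    by metis
  show thesis
  proof (rule that[of "\<lambda>x. \<Sum>i\<in>Basis. k i x *\<^sub>R i"])
    show "(\<lambda>x. \<Sum>i\<in>Basis. k i x *\<^sub>R i) \<in> borel_measurable borel"
      using k(1) by (intro borel_measurable_sum borel_measurable_scaleR) auto
    have "AE x in lborel. \<forall>i\<in>Basis. inner (g x) i = k i x"
      using k(2) by (intro AE_finite_allI) auto
    then show "AE x in lborel. g x = (\<Sum>i\<in>Basis. k i x *\<^sub>R i)"
    proof eventually_elim
      case (elim x)
      then have "(\<Sum>i\<in>Basis. k i x *\<^sub>R i) = (\<Sum>i\<in>Basis. inner (g x) i *\<^sub>R i)" by (intro sum.cong) auto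
      then show ?case by (simp add: euclidean_representation)
    qed
  qed
qed

lemma
  fixes g g' :: "'a::euclidean_space \<Rightarrow> 'b::euclidean_space"
  assumes g': "g' \<in> borel_measurable borel" and ae: "AE x in lborel. g x = g' x"
  shows lebesgue_integral_borel_representative: "(LINT x|lebesgue. g x) = (LINT x|lborel. g' x)"
    and lebesgue_integrable_borel_representative: "integrable lebesgue g \<longleftrightarrow> integrable lborel g'"
proof -
  have g'': "g' \<in> borel_measurable lborel" "g' \<in> borel_measurable lebesgue"
    using g' by (auto intro: measurable_completion)
  have ae': "AE x in lebesgue. g' x = g x"
    using ae by (intro AE_completion) auto
  have g: "g \<in> borel_measurable lebesgue"
    using borel_measurable_AE[OF g''(2) ae'] .
  show "(LINT x|lebesgue. g x) = (LINT x|lborel. g' x)"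
    using integral_cong_AE[OF g''(2) g ae'] integral_completion[OF g''(1)] by simp
  show "integrable lebesgue g \<longleftrightarrow> integrable lborel g'"
    using integrable_cong_AE[OF g''(2) g ae'] integrable_completion[OF g''(1)] by simp
qed

lemma
  fixes P :: "'a::euclidean_space \<Rightarrow> bool"
  assumes P: "AE x in lborel. P x"
  shows AE_lborel_shift: "AE x in lborel. P (x + c)"
    and AE_lborel_reflect: "AE x in lborel. P (c - x)"
proof -
  show "AE x in lborel. P (x + c)"
    using P by (subst (asm) lborel_distr_shift[of c, symmetric]) (rule AE_distrD[rotated], auto)
  show "AE x in lborel. P (c - x)"
    using P by (subst (asm) lborel_distr_reflect[of c, symmetric]) (rule AE_distrD[rotated], auto)
qed

theorem theorem3p3:
  fixes \<phi> f :: "real ^ 2 \<Rightarrow> quat"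
  assumes "\<phi> \<in> L2" and "\<not> (AE x in lebesgue. \<phi> x = 0)" and "f \<in> L2"
  shows "(\<forall>K. (\<forall>n. K n \<in> lmeasurable) \<and> incseq K \<and> (\<Union>n. K n) = UNIV \<longrightarrow>
            L2_tendsto
              (\<lambda>n x. (1 / (L2norm \<phi>)\<^sup>2) *\<^sub>R
                (LINT b|lebesgue. (LINT \<omega>:K n|lebesgue. gqft_synthesis \<phi> f x \<omega> b))) f) \<and>
         (AE x in lebesgue.
            (AE b in lebesgue. integrable lebesgue (\<lambda>\<omega>. gqft_synthesis \<phi> f x \<omega> b)) \<longrightarrow>
            f x = (1 / (L2norm \<phi>)\<^sup>2) *\<^sub>R
              (LINT b|lebesgue. LINT \<omega>|lebesgue. gqft_synthesis \<phi> f x \<omega> b))"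
proof -
  have \<phi>: "\<phi> \<in> borel_measurable lebesgue" "integrable lebesgue (\<lambda>x. (norm (\<phi> x))\<^sup>2)"
    and f: "f \<in> borel_measurable lebesgue" "integrable lebesgue (\<lambda>x. (norm (f x))\<^sup>2)"
    using assms by (auto simp: L2_def)
  obtain \<phi>' where \<phi>'[measurable]: "\<phi>' \<in> borel_measurable borel" and \<phi>_AE: "AE x in lborel. \<phi> x = \<phi>' x"
    using lebesgue_measurable_borel_representative[OF \<phi>(1)] .
  obtain f' where f'[measurable]: "f' \<in> borel_measurable borel" and f_AE: "AE x in lborel. f x = f' x"
    using lebesgue_measurable_borel_representative[OF f(1)] .
  have ae2: "AE x in lborel. (norm (\<phi> x))\<^sup>2 = (norm (\<phi>' x))\<^sup>2" "AE x in lborel. (norm (f x))\<^sup>2 = (norm (f' x))\<^sup>2"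
    using \<phi>_AE f_AE by auto
  interpret borel_gabor_pair \<phi>' f'
    using lebesgue_integrable_borel_representative[OF _ ae2(1)]
      lebesgue_integrable_borel_representative[OF _ ae2(2)] \<phi>(2) f(2)
    by unfold_locales auto
  have N: "(L2norm \<phi>)\<^sup>2 = N"
    using lebesgue_integral_borel_representative[OF _ ae2(1)] N_nonneg by (simp add: L2norm_def N_def)
  have N_pos: "0 < N"
  proof (rule ccontr)
    assume "\<not> 0 < N"
    then have "N = 0" using N_nonneg by simp
    then have "AE x in lborel. \<phi>' x = 0"
      using integral_nonneg_eq_0_iff_AE[OF phi2] by (simp add: N_def)
    with \<phi>_AE have "AE x in lborel. \<phi> x = 0" by eventually_elim simp
    then show False using assms(2) AE_completion by blast
  qed
  have \<phi>_shift: "AE x in lborel. \<phi> (x - b) = \<phi>' (x - b)" "AE y in lborel. \<phi> (b - y) = \<phi>' (b - y)" for b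
    using AE_lborel_shift[OF \<phi>_AE, of "- b"] AE_lborel_reflect[OF \<phi>_AE, of b] by simp_all
  \<comment> \<open>Equality at every \<open>\<omega>\<close> and \<open>b\<close>: for fixed
    \<open>b\<close> the integrands differ only on a null set of \<open>x\<close>.\<close>
  have gqft: "gqft \<phi> f \<omega> b = G b \<omega>" for \<omega> b
  proof -
    have "gqft \<phi> f \<omega> b = (LINT x|lebesgue. qker \<omega> x (f x * qcnj (\<phi> (x - b))))"
      by (simp add: gqft_def qker_def mult.assoc)
    also have "\<dots> = (LINT x|lborel. qker \<omega> x (windowed b x))"
    proof (rule lebesgue_integral_borel_representative)
      show "AE x in lborel. qker \<omega> x (f x * qcnj (\<phi> (x - b))) = qker \<omega> x (windowed b x)"
        using f_AE \<phi>_shift(1)[of b] by eventually_elim (simp add: windowed_def)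
    qed measurable
    finally show ?thesis by (simp add: G_def qft_def)
  qed
  \<comment> \<open>The window factor has to remain \<open>\<phi>\<close> here, since
    \<open>\<phi>'\<close> may differ from it at individual points \<open>x - b\<close>; it is
    replaced only under the integral over \<open>b\<close>.\<close>
  have synth: "gqft_synthesis \<phi> f x \<omega> b = qker \<omega> (- x) (G b \<omega>) * \<phi> (x - b)" for x \<omega> b
    by (simp add: gqft_synthesis_def gqft qker_def)
  have part1: "L2_tendsto
              (\<lambda>n x. (1 / (L2norm \<phi>)\<^sup>2) *\<^sub>R
                (LINT b|lebesgue. (LINT \<omega>:K n|lebesgue. gqft_synthesis \<phi> f x \<omega> b))) f"
    if K: "\<And>n. K n \<in> lmeasurable" "incseq K" "(\<Union>n. K n) = UNIV" for K
  proof -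
    \<comment> \<open>A Borel subset of \<open>K n\<close> of the same measure, as the Borel results
      require; only a null set of frequencies is lost.\<close>
    define K' where "K' n = main_part lborel (K n)" for n
    have Ks: "K n \<in> sets (completion lborel)" for n using K(1) by (simp add: fmeasurable_def)
    have K'[measurable]: "K' n \<in> sets borel" for n
      using main_part_sets[OF Ks[of n]] by (simp add: K'_def)
    have K'fin: "emeasure lborel (K' n) < \<infinity>" for n
      using K(1)[of n] Ks[of n] by (simp add: K'_def fmeasurable_def)
    have KK': "AE \<omega> in lborel. \<omega> \<in> K n \<longleftrightarrow> \<omega> \<in> K' n" for n
      using AE_notin_null_part[OF Ks[of n]]
    proof eventually_elim
      case (elim \<omega>)
      then show ?case using main_part_null_part_Un[OF Ks[of n]] by (auto simp: K'_def)
    qed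
    \<comment> \<open>The exceptional sets for all \<open>n\<close> form a countable union, so
      outside one null set eventual membership in the increasing \<open>K n\<close> carries over to
      \<open>K' n\<close>.\<close>
    have lim: "AE \<omega> in lborel. \<forall>\<^sub>F n in sequentially. \<omega> \<in> K' n"
    proof -
      have "AE \<omega> in lborel. \<forall>n. \<omega> \<in> K n \<longleftrightarrow> \<omega> \<in> K' n"
        using KK' by (simp add: AE_all_countable)
      then show ?thesis
      proof eventually_elim
        case (elim \<omega>)
        obtain m where "\<omega> \<in> K m" using K(3) by auto
        then have "\<omega> \<in> K n" if "m \<le> n" for n using K(2) that by (auto simp: incseq_def)
        then show ?case using elim by (auto intro!: eventually_sequentiallyI[of m])
      qed
    qed
    have inner: "(LINT \<omega>:K n|lebesgue. gqft_synthesis \<phi> f x \<omega> b) = truncated (K' n) b x * \<phi> (x - b)" for n x b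
    proof -
      have "(LINT \<omega>:K n|lebesgue. gqft_synthesis \<phi> f x \<omega> b)
          = (LINT \<omega>|lborel. qker (- x) \<omega> (indicator (K' n) \<omega> *\<^sub>R G b \<omega>) * \<phi> (x - b))"
        unfolding set_lebesgue_integral_def synth
      proof (rule lebesgue_integral_borel_representative)
        show "AE \<omega> in lborel. indicator (K n) \<omega> *\<^sub>R (qker \<omega> (- x) (G b \<omega>) * \<phi> (x - b))
            = qker (- x) \<omega> (indicator (K' n) \<omega> *\<^sub>R G b \<omega>) * \<phi> (x - b)"
          using KK'[of n] by eventually_elim (auto simp: qker_commute[of "- x"] split: split_indicator)
      qed measurable
      also have "\<dots> = truncated (K' n) b x * \<phi> (x - b)"
      proof -
        have "integrable lborel (\<lambda>\<omega>. indicator (K' n) \<omega> *\<^sub>R G b \<omega>)"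
          using K'fin[of n] norm_qft_le[OF windowed_integrable, of b]
          by (intro integrable_indicator_scaleR_bounded) (auto simp: G_def)
        from integrable_qker[OF this, of "- x"] show ?thesis
          unfolding truncated_def qft_def[of "\<lambda>\<omega>. indicator (K' n) \<omega> *\<^sub>R G b \<omega>"] by simp
      qed
      finally show ?thesis .
    qed
    have outer: "(1 / (L2norm \<phi>)\<^sup>2) *\<^sub>R (LINT b|lebesgue. (LINT \<omega>:K n|lebesgue. gqft_synthesis \<phi> f x \<omega> b))
        = reconstruction (K' n) x" for n x
    proof -
      have "(LINT b|lebesgue. truncated (K' n) b x * \<phi> (x - b)) = (LINT b|lborel. truncated (K' n) b x * \<phi>' (x - b))"
      proof (rule lebesgue_integral_borel_representative)
        show "AE b in lborel. truncated (K' n) b x * \<phi> (x - b) = truncated (K' n) b x * \<phi>' (x - b)"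
          using \<phi>_shift(2)[of x] by eventually_elim simp
      qed measurable
      then show ?thesis by (simp add: inner N reconstruction_def)
    qed
    \<comment> \<open>Membership is read off from the error: adding the square-integrable
      \<open>f'\<close> back to a square-integrable difference.\<close>
    have SL2: "reconstruction (K' n) \<in> L2" for n
    proof -
      have "integrable lborel (\<lambda>x. (norm ((reconstruction (K' n) x - f' x) - (- f' x)))\<^sup>2)"
        by (rule integrable_norm_diff_square[OF _ _ reconstruction_error_integrable[OF K' K'fin N_pos]]) (use f2 in simp_all)
      then have "integrable lebesgue (\<lambda>x. (norm (reconstruction (K' n) x))\<^sup>2)"
        by (subst integrable_completion) simp_all
      moreover have "reconstruction (K' n) \<in> borel_measurable lebesgue"
        by (rule measurable_completion) simp
      ultimately show ?thesis by (simp add: L2_def)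
    qed
    have "L2norm (\<lambda>x. reconstruction (K' n) x - f x) = sqrt (LINT x|lborel. (norm (reconstruction (K' n) x - f' x))\<^sup>2)" for n
    proof -
      have "(LINT x|lebesgue. (norm (reconstruction (K' n) x - f x))\<^sup>2) = (LINT x|lborel. (norm (reconstruction (K' n) x - f' x))\<^sup>2)"
      proof (rule lebesgue_integral_borel_representative)
        show "AE x in lborel. (norm (reconstruction (K' n) x - f x))\<^sup>2 = (norm (reconstruction (K' n) x - f' x))\<^sup>2"
          using f_AE by eventually_elim simp
      qed measurable
      then show ?thesis by (simp add: L2norm_def)
    qed
    then have "(\<lambda>n. L2norm (\<lambda>x. reconstruction (K' n) x - f x)) \<longlonglongrightarrow> 0"
      using tendsto_real_sqrt[OF reconstruction_tendsto[OF K' K'fin N_pos lim]] by simp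
    then show ?thesis
      unfolding L2_tendsto_def outer using SL2 assms(3) by simp
  qed
  have part2: "AE x in lebesgue.
            (AE b in lebesgue. integrable lebesgue (\<lambda>\<omega>. gqft_synthesis \<phi> f x \<omega> b)) \<longrightarrow>
            f x = (1 / (L2norm \<phi>)\<^sup>2) *\<^sub>R
              (LINT b|lebesgue. LINT \<omega>|lebesgue. gqft_synthesis \<phi> f x \<omega> b)"
  proof (rule AE_completion)
    show "AE x in lborel.
            (AE b in lebesgue. integrable lebesgue (\<lambda>\<omega>. gqft_synthesis \<phi> f x \<omega> b)) \<longrightarrow>
            f x = (1 / (L2norm \<phi>)\<^sup>2) *\<^sub>R
              (LINT b|lebesgue. LINT \<omega>|lebesgue. gqft_synthesis \<phi> f x \<omega> b)"
      using inversion_AE[OF N_pos] f_AE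
    proof eventually_elim
      case (elim x)
      show ?case
      proof
        assume "AE b in lebesgue. integrable lebesgue (\<lambda>\<omega>. gqft_synthesis \<phi> f x \<omega> b)"
        then have "AE b in lborel. integrable lebesgue (\<lambda>\<omega>. gqft_synthesis \<phi> f x \<omega> b)"
          by (simp only: AE_completion_iff)
        then have "AE b in lborel. integrable lborel (\<lambda>\<omega>. qker \<omega> (- x) (G b \<omega>) * \<phi>' (x - b))"
          using \<phi>_shift(2)[of x]
        proof eventually_elim
          case (elim b)
          then show ?case by (simp add: synth integrable_completion)
        qed
        with elim have "f x = (1 / N) *\<^sub>R (LINT b|lborel. LINT \<omega>|lborel. qker \<omega> (- x) (G b \<omega>) * \<phi>' (x - b))"
          by simp
        also have "(LINT b|lborel. LINT \<omega>|lborel. qker \<omega> (- x) (G b \<omega>) * \<phi>' (x - b))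
            = (LINT b|lebesgue. LINT \<omega>|lebesgue. gqft_synthesis \<phi> f x \<omega> b)"
        proof (rule lebesgue_integral_borel_representative[symmetric])
          show "AE b in lborel. (LINT \<omega>|lebesgue. gqft_synthesis \<phi> f x \<omega> b)
              = (LINT \<omega>|lborel. qker \<omega> (- x) (G b \<omega>) * \<phi>' (x - b))"
            using \<phi>_shift(2)[of x]
            by eventually_elim (simp add: synth integral_completion)
        qed measurable
        finally show "f x = (1 / (L2norm \<phi>)\<^sup>2) *\<^sub>R
              (LINT b|lebesgue. LINT \<omega>|lebesgue. gqft_synthesis \<phi> f x \<omega> b)"
          by (simp only: N)
      qed
    qed
  qed
  from part1 part2 show ?thesis by blast
qed

end
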